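(* Let $X$ and $Y$ be metrizable spaces, and let $\operatorname{M}$ denote either $\mathrm{Pc}$ or $\mathrm{Pp}$ (the same choice for $X$ and for $Y$). The following are equivalent: (1) $X$ and $Y$ are homeomorphic; (2) there exists an isometry $T : \operatorname{PM}(X) \to \operatorname{PM}(Y)$ with $T(\operatorname{M}(X)) = \operatorname{M}(Y)$; (3) there exists an isometry $T : \operatorname{AM}(X) \to \operatorname{AM}(Y)$ with $T(\operatorname{M}(X)) = \operatorname{M}(Y)$; (4) there exists an isometry $T : \operatorname{M}(X) \to \operatorname{M}(Y)$. In this case, for each isometry $T : \operatorname{PM}(X) \to \operatorname{PM}(Y)$ with $T(\operatorname{M}(X)) = \operatorname{M}(Y)$, there exists a homeomorphism $\phi : Y \to X$ such that for any $d \in \operatorname{PM}(X)$ and for any $x, y \in Y$, $$T(d)(x,y) = d(\phi(x),\phi(y)).$$ Except for the case where the cardinality of $X$ or $Y$ is equal to $2$, the homeomorphism $\phi$ can be chosen uniquely.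
   Context: For a metrizable space $Z$, $\operatorname{PM}(Z)$ is the space of continuous bounded pseudometrics $d : Z^2 \to [0,\infty)$, equipped with the sup-norm $\|d\| = \sup\{d(z,w) \mid z,w \in Z\}$ and the induced sup-metric $(d,d') \mapsto \|d-d'\| = \sup_{(z,w)\in Z^2}|d(z,w)-d'(z,w)|$. $\operatorname{AM}(Z) \subset \operatorname{PM}(Z)$ is the subspace of continuous bounded admissible metrics (bounded metrics inducing the topology of $Z$). $\mathrm{Pc}(Z)$ is the set of all $d \in \operatorname{AM}(Z)$ for which there is a compact set $K \subset Z$ such that whenever $x,y\in Z$ satisfy $d(x,y) = \|d\|$, then $x, y \in K$. $\mathrm{Pp}(Z)$ is the set of all $d \in \operatorname{AM}(Z)$ for which there is exactly one subset $\{z,w\} \subset Z$ ($z = w$ allowed) with $d(z,w) = \|d\|$. All subspaces carry the restricted sup-metric. An isometry means a surjective distance-preserving map. *)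

theory Defs
  imports "HOL-Analysis.Analysis"
begin

text \<open>
  A function \<open>d : Z\<^sup>2 \<rightarrow> [0,\<infinity>)\<close> is represented by a total curried function that vanishes as soon
  as one argument lies outside \<open>topspace Z\<close>. This makes the representation unique, so that equality
  in \<open>PM Z\<close> is equality of functions on \<open>topspace Z \<times> topspace Z\<close>. The value outside is \<open>0\<close> and not
  \<open>undefined\<close> because \<^locale>\<open>Metric_space\<close> requires non-negativity and symmetry at all
  elements of the type.
\<close>

definition PM :: "'a topology \<Rightarrow> ('a \<Rightarrow> 'a \<Rightarrow> real) set" where
  "PM Z = {d.
     (\<forall>x y. x \<notin> topspace Z \<or> y \<notin> topspace Z \<longrightarrow> d x y = 0) \<and>
     (\<forall>x\<in>topspace Z. \<forall>y\<in>topspace Z. 0 \<le> d x y) \<and>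
     (\<forall>x\<in>topspace Z. d x x = 0) \<and>
     (\<forall>x\<in>topspace Z. \<forall>y\<in>topspace Z. d x y = d y x) \<and>
     (\<forall>x\<in>topspace Z. \<forall>y\<in>topspace Z. \<forall>z\<in>topspace Z. d x z \<le> d x y + d y z) \<and>
     (\<exists>B. \<forall>x\<in>topspace Z. \<forall>y\<in>topspace Z. d x y \<le> B) \<and>
     continuous_map (prod_topology Z Z) euclideanreal (\<lambda>(x, y). d x y)}"

definition AM :: "'a topology \<Rightarrow> ('a \<Rightarrow> 'a \<Rightarrow> real) set" where
  "AM Z = {d \<in> PM Z. Metric_space (topspace Z) d \<and> Metric_space.mtopology (topspace Z) d = Z}"

text \<open>
  Suprema are taken in \<^typ>\<open>real\<close>, so the next two notions are meaningful only for non-empty \<open>Z\<close>.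
\<close>

definition pm_norm :: "'a topology \<Rightarrow> ('a \<Rightarrow> 'a \<Rightarrow> real) \<Rightarrow> real" where
  "pm_norm Z d = (SUP (z, w) \<in> topspace Z \<times> topspace Z. d z w)"

definition pm_dist :: "'a topology \<Rightarrow> ('a \<Rightarrow> 'a \<Rightarrow> real) \<Rightarrow> ('a \<Rightarrow> 'a \<Rightarrow> real) \<Rightarrow> real" where
  "pm_dist Z d d' = (SUP (z, w) \<in> topspace Z \<times> topspace Z. \<bar>d z w - d' z w\<bar>)"

definition Pc :: "'a topology \<Rightarrow> ('a \<Rightarrow> 'a \<Rightarrow> real) set" where
  "Pc Z = {d \<in> AM Z. \<exists>K. compactin Z K \<and>
     (\<forall>x\<in>topspace Z. \<forall>y\<in>topspace Z. d x y = pm_norm Z d \<longrightarrow> x \<in> K \<and> y \<in> K)}"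

definition Pp :: "'a topology \<Rightarrow> ('a \<Rightarrow> 'a \<Rightarrow> real) set" where
  "Pp Z = {d \<in> AM Z.
     \<exists>!S. \<exists>z\<in>topspace Z. \<exists>w\<in>topspace Z. S = {z, w} \<and> d z w = pm_norm Z d}"

definition pm_isometry ::
  "'a topology \<Rightarrow> ('a \<Rightarrow> 'a \<Rightarrow> real) set \<Rightarrow> 'b topology \<Rightarrow> ('b \<Rightarrow> 'b \<Rightarrow> real) set \<Rightarrow>
   (('a \<Rightarrow> 'a \<Rightarrow> real) \<Rightarrow> ('b \<Rightarrow> 'b \<Rightarrow> real)) \<Rightarrow> bool" where
  "pm_isometry X A Y B T \<longleftrightarrow>
     T ` A = B \<and> (\<forall>d\<in>A. \<forall>d'\<in>A. pm_dist Y (T d) (T d') = pm_dist X d d')"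

end

theory Submission
  imports Defs
begin

text \<open>
  A homeomorphism transports pseudometrics isometrically and preserves all classes involved, so the
  content lies in recovering a homeomorphism from an isometry.

  \<^bold>\<open>Reduction to \<open>PM\<close>.\<close> The set \<open>Pp Z\<close> is contained in \<open>Pc Z\<close> and is dense in \<open>PM Z\<close>
  (\<open>Pp_dense\<close>): near the supremum of an admissible metric one can raise a small peak. Since \<open>PM Z\<close> is
  complete, an isometry between \<open>M X\<close> and \<open>M Y\<close> extends to one between \<open>PM X\<close> and \<open>PM Y\<close>
  (\<open>isometry_extends_to_PM\<close>); isometries of \<open>PM\<close> or \<open>AM\<close> that match \<open>M X\<close> with \<open>M Y\<close> restrict
  to such isometries. It remains to see that an isometry \<open>T\<close> from \<open>PM X\<close> onto \<open>PM Y\<close> comes from a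
  homeomorphism (\<open>PM_isometry_induced_by_homeomorphism\<close>).

  \<^bold>\<open>Pairs of points are metric data.\<close> Let \<open>p\<close> peak strongly at a pair \<open>(a, b)\<close> of distinct points,
  with maximum \<open>1\<close>. Then the distance from \<open>t p\<close> to \<open>e\<close> is \<open>t - e a b + o(1)\<close> as \<open>t \<rightarrow> \<infinity>\<close>, so evaluation at
  \<open>(a, b)\<close> is determined by the metric of \<open>PM X\<close> and a ray in it (\<open>busemann_limit\<close>). Applying \<open>T\<close> to the
  ray gives pairs in \<open>Y\<close> at which the values of \<open>T e\<close> dominate those of \<open>e\<close> at \<open>(a, b)\<close>,
  simultaneously for finitely many \<open>e\<close> and up to an error; applying the same to the inverse of \<open>T\<close> turns
  this into approximate equality (\<open>isometry_approximates_pair\<close>).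

  \<^bold>\<open>Passing to the limit.\<close> Refining the approximation yields a sequence of pairs in \<open>Y\<close> along which
  every element of \<open>PM Y\<close> converges. Because \<open>Y\<close> is metrizable, such a sequence has a limit pair in
  \<open>Y\<close> itself (\<open>pseudometrically_convergent_pairs_have_limit_point\<close>), whence \<open>T e u v = e a b\<close> for all
  \<open>e\<close> and some pair \<open>(u, v)\<close> (\<open>isometry_transports_pair\<close>).

  \<^bold>\<open>From pairs to points.\<close> This is a bijection between the edges of the complete graphs on \<open>X\<close> and
  \<open>Y\<close>. Pseudometrics satisfy the triangle inequality, and this inequality characterises triangles of
  edges (\<open>pairs_form_triangle\<close>), so triangles go to triangles and the bijection is induced by one
  of points (\<open>triangle_preserving_edge_map_is_induced\<close>). It is a homeomorphism since it transports
  continuous pseudometrics in both directions. It is determined by its action on pairs, except that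
  the two points of a two-point space may be interchanged.
\<close>

section \<open>Bounded continuous pseudometrics\<close>

lemma PM_outside: "d \<in> PM Z \<Longrightarrow> x \<notin> topspace Z \<or> y \<notin> topspace Z \<Longrightarrow> d x y = 0"
  unfolding PM_def by blast

lemma PM_nonneg: "d \<in> PM Z \<Longrightarrow> 0 \<le> d x y"
  unfolding PM_def by (cases "x \<in> topspace Z \<and> y \<in> topspace Z") auto

lemma PM_refl: "d \<in> PM Z \<Longrightarrow> d x x = 0"
  unfolding PM_def by (cases "x \<in> topspace Z") auto

lemma PM_commute: "d \<in> PM Z \<Longrightarrow> d x y = d y x"
  unfolding PM_def by (cases "x \<in> topspace Z \<and> y \<in> topspace Z") auto

lemma PM_triangle:
  "d \<in> PM Z \<Longrightarrow> x \<in> topspace Z \<Longrightarrow> y \<in> topspace Z \<Longrightarrow> z \<in> topspace Z \<Longrightarrow> d x z \<le> d x y + d y z"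
  unfolding PM_def by blast

lemma PM_bounded:
  assumes "d \<in> PM Z"
  obtains B where "B > 0" "\<And>x y. d x y \<le> B"
proof -
  obtain B where B: "\<forall>x\<in>topspace Z. \<forall>y\<in>topspace Z. d x y \<le> B"
    using assms unfolding PM_def by blast
  have "d x y \<le> max B 1" for x y
    using B PM_outside[OF assms, of x y]
    by (cases "x \<in> topspace Z \<and> y \<in> topspace Z") (auto simp: le_max_iff_disj)
  then show ?thesis using that[of "max B 1"] by auto
qed

lemma PM_eqI:
  assumes "d \<in> PM Z" "d' \<in> PM Z"
    and "\<And>x y. x \<in> topspace Z \<Longrightarrow> y \<in> topspace Z \<Longrightarrow> d x y = d' x y"
  shows "d = d'"
proof (intro ext)
  show "d x y = d' x y" for x y
    using assms PM_outside[OF assms(1), of x y] PM_outside[OF assms(2), of x y]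
    by (cases "x \<in> topspace Z \<and> y \<in> topspace Z") auto
qed

lemma continuous_map_euclideanreal_iff:
  "continuous_map Z euclideanreal f \<longleftrightarrow>
    (\<forall>x \<in> topspace Z. \<forall>\<epsilon>>0. \<exists>U. openin Z U \<and> x \<in> U \<and> (\<forall>y\<in>U. \<bar>f y - f x\<bar> < \<epsilon>))"
  using Met_TC.continuous_map_to_metric[of Z f]
  by (simp add: dist_real_def abs_minus_commute flip: mtopology_is_euclidean)

lemma PM_continuous_map:
  assumes d: "d \<in> PM Z" and a: "a \<in> topspace Z"
  shows "continuous_map Z euclideanreal (d a)"
proof -
  have 1: "continuous_map Z (prod_topology Z Z) (\<lambda>x. (a, x))"
    using a by (intro continuous_intros) auto
  have 2: "continuous_map (prod_topology Z Z) euclideanreal (\<lambda>(x, y). d x y)"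
    using d unfolding PM_def by blast
  show ?thesis
    using continuous_map_compose[OF 1 2] by (simp add: o_def)
qed

lemma PM_continuous_map': "d \<in> PM Z \<Longrightarrow> a \<in> topspace Z \<Longrightarrow> continuous_map Z euclideanreal (\<lambda>x. d x a)"
  using PM_continuous_map[of d Z a] PM_commute[of d Z] by (metis (no_types, lifting) ext)

lemma PM_small_nhd:
  assumes d: "d \<in> PM Z" and a: "a \<in> topspace Z" and "\<epsilon> > 0"
  obtains U where "openin Z U" "a \<in> U" "\<And>x. x \<in> U \<Longrightarrow> d a x < \<epsilon>"
  using PM_continuous_map[OF d a] a \<open>\<epsilon> > 0\<close> PM_refl[OF d, of a] PM_nonneg[OF d]
  unfolding continuous_map_euclideanreal_iff by (metis abs_of_nonneg diff_zero)

lemma PM_quad: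
  assumes d: "d \<in> PM Z"
    and "x \<in> topspace Z" "y \<in> topspace Z" "x' \<in> topspace Z" "y' \<in> topspace Z"
  shows "\<bar>d x y - d x' y'\<bar> \<le> d x' x + d y' y"
proof -
  have "d x y \<le> d x x' + d x' y" "d x' y \<le> d x' y' + d y' y"
    "d x' y' \<le> d x' x + d x y'" "d x y' \<le> d x y + d y y'"
    using assms PM_triangle[OF d] by auto
  then show ?thesis
    using PM_commute[OF d, of x x'] PM_commute[OF d, of y y'] by linarith
qed

text \<open>
  By the triangle inequality, joint continuity only has to be checked at the diagonal, one
  variable at a time.
\<close>

lemma PM_I:
  assumes outside: "\<And>x y. x \<notin> topspace Z \<or> y \<notin> topspace Z \<Longrightarrow> d x y = 0"
    and nonneg: "\<And>x y. x \<in> topspace Z \<Longrightarrow> y \<in> topspace Z \<Longrightarrow> 0 \<le> d x y"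
    and refl: "\<And>x. x \<in> topspace Z \<Longrightarrow> d x x = 0"
    and commute: "\<And>x y. x \<in> topspace Z \<Longrightarrow> y \<in> topspace Z \<Longrightarrow> d x y = d y x"
    and triangle: "\<And>x y z. x \<in> topspace Z \<Longrightarrow> y \<in> topspace Z \<Longrightarrow> z \<in> topspace Z
                     \<Longrightarrow> d x z \<le> d x y + d y z"
    and bounded: "\<And>x y. x \<in> topspace Z \<Longrightarrow> y \<in> topspace Z \<Longrightarrow> d x y \<le> B"
    and small: "\<And>a \<epsilon>. a \<in> topspace Z \<Longrightarrow> 0 < \<epsilon> \<Longrightarrow> \<exists>U. openin Z U \<and> a \<in> U \<and> (\<forall>x\<in>U. d a x < \<epsilon>)"
  shows "d \<in> PM Z"
proof -
  have "continuous_map (prod_topology Z Z) euclideanreal (\<lambda>(x, y). d x y)"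
    unfolding continuous_map_euclideanreal_iff
  proof (intro ballI allI impI)
    fix p and \<epsilon> :: real
    assume p: "p \<in> topspace (prod_topology Z Z)" and "\<epsilon> > 0"
    obtain a b where ab: "p = (a, b)" "a \<in> topspace Z" "b \<in> topspace Z"
      using p by auto
    obtain U where U: "openin Z U" "a \<in> U" "\<And>x. x \<in> U \<Longrightarrow> d a x < \<epsilon>/2"
      using small[OF ab(2), of "\<epsilon>/2"] \<open>\<epsilon> > 0\<close> by auto
    obtain V where V: "openin Z V" "b \<in> V" "\<And>x. x \<in> V \<Longrightarrow> d b x < \<epsilon>/2"
      using small[OF ab(3), of "\<epsilon>/2"] \<open>\<epsilon> > 0\<close> by auto
    have "\<bar>d x y - d a b\<bar> < \<epsilon>" if "x \<in> U" "y \<in> V" for x y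
    proof -
      have xy: "x \<in> topspace Z" "y \<in> topspace Z"
        using U(1) V(1) that openin_subset by blast+
      have "d x y \<le> d x a + d a y" "d a y \<le> d a b + d b y"
        "d a b \<le> d a x + d x b" "d x b \<le> d x y + d y b"
        using xy ab triangle by auto
      then show ?thesis
        using U(3)[OF that(1)] V(3)[OF that(2)] commute[OF xy(1) ab(2)] commute[OF xy(2) ab(3)]
        by linarith
    qed
    then show "\<exists>W. openin (prod_topology Z Z) W \<and> p \<in> W \<and>
        (\<forall>q\<in>W. \<bar>(case q of (x, y) \<Rightarrow> d x y) - (case p of (x, y) \<Rightarrow> d x y)\<bar> < \<epsilon>)"
      using ab U V by (intro exI[of _ "U \<times> V"]) (auto simp: openin_prod_Times_iff)
  qed
  then show ?thesis
    unfolding PM_def using outside nonneg refl commute triangle bounded by blast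
qed

lemma PM_add:
  assumes d: "d \<in> PM Z" and e: "e \<in> PM Z"
  shows "(\<lambda>x y. d x y + e x y) \<in> PM Z"
proof -
  obtain B where B: "\<And>x y. d x y \<le> B" using PM_bounded[OF d] by metis
  obtain C where C: "\<And>x y. e x y \<le> C" using PM_bounded[OF e] by metis
  show ?thesis
  proof (rule PM_I[where B = "B + C"])
    fix a and \<epsilon> :: real assume a: "a \<in> topspace Z" "\<epsilon> > 0"
    obtain U where U: "openin Z U" "a \<in> U" "\<And>x. x \<in> U \<Longrightarrow> d a x < \<epsilon>/2"
      using PM_small_nhd[OF d a(1), of "\<epsilon>/2"] a by (metis half_gt_zero)
    obtain V where V: "openin Z V" "a \<in> V" "\<And>x. x \<in> V \<Longrightarrow> e a x < \<epsilon>/2"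
      using PM_small_nhd[OF e a(1), of "\<epsilon>/2"] a by (metis half_gt_zero)
    show "\<exists>U. openin Z U \<and> a \<in> U \<and> (\<forall>x\<in>U. d a x + e a x < \<epsilon>)"
      using U V by (intro exI[of _ "U \<inter> V"]) (fastforce intro: openin_Int)
  next
    fix x y z assume "x \<in> topspace Z" "y \<in> topspace Z" "z \<in> topspace Z"
    then show "d x z + e x z \<le> d x y + e x y + (d y z + e y z)"
      using PM_triangle[OF d, of x y z] PM_triangle[OF e, of x y z] by simp
  qed (use PM_outside[OF d] PM_outside[OF e] PM_refl[OF d] PM_refl[OF e] PM_commute[OF d]
      PM_commute[OF e] PM_nonneg[OF d] PM_nonneg[OF e] B C in \<open>auto intro: add_mono\<close>)
qed

lemma PM_scale:
  assumes d: "d \<in> PM Z" and c: "c \<ge> 0"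
  shows "(\<lambda>x y. c * d x y) \<in> PM Z"
proof -
  obtain B where B: "\<And>x y. d x y \<le> B" using PM_bounded[OF d] by metis
  show ?thesis
  proof (rule PM_I[where B = "c * B"])
    fix a and \<epsilon> :: real assume a: "a \<in> topspace Z" "\<epsilon> > 0"
    have pos: "\<epsilon> / (c + 1) > 0" using a c by simp
    obtain U where U: "openin Z U" "a \<in> U" "\<And>x. x \<in> U \<Longrightarrow> d a x < \<epsilon> / (c + 1)"
      using PM_small_nhd[OF d a(1) pos] by blast
    have "c * d a x < \<epsilon>" if "x \<in> U" for x
    proof -
      have "(c + 1) * d a x < \<epsilon>" using U(3)[OF that] c by (simp add: field_simps)
      then show ?thesis using PM_nonneg[OF d, of a x] by (simp add: algebra_simps)
    qed
    then show "\<exists>U. openin Z U \<and> a \<in> U \<and> (\<forall>x\<in>U. c * d a x < \<epsilon>)"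
      using U by blast
  next
    fix x y z assume "x \<in> topspace Z" "y \<in> topspace Z" "z \<in> topspace Z"
    then show "c * d x z \<le> c * d x y + c * d y z"
      using mult_left_mono[OF PM_triangle[OF d, of x y z] c] by (simp add: distrib_left)
  qed (use c PM_outside[OF d] PM_refl[OF d] PM_commute[OF d] PM_nonneg[OF d] B
      in \<open>auto intro: mult_left_mono\<close>)
qed

lemma PM_zero: "(\<lambda>x y. 0) \<in> PM Z"
  by (rule PM_I[where B = 0]) auto

definition fun_pm :: "'a topology \<Rightarrow> ('a \<Rightarrow> real) \<Rightarrow> 'a \<Rightarrow> 'a \<Rightarrow> real" where
  "fun_pm Z f x y = (if x \<in> topspace Z \<and> y \<in> topspace Z then \<bar>f x - f y\<bar> else 0)"

lemma fun_pm_in_PM: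
  assumes f: "continuous_map Z euclideanreal f" and B: "\<And>x. x \<in> topspace Z \<Longrightarrow> \<bar>f x\<bar> \<le> B"
  shows "fun_pm Z f \<in> PM Z"
proof (rule PM_I[where B = "2 * B"])
  fix a and \<epsilon> :: real assume a: "a \<in> topspace Z" "\<epsilon> > 0"
  then obtain U where U: "openin Z U" "a \<in> U" "\<forall>x\<in>U. \<bar>f x - f a\<bar> < \<epsilon>"
    using f unfolding continuous_map_euclideanreal_iff by blast
  have "\<forall>x\<in>U. fun_pm Z f a x < \<epsilon>"
    using U(3) a by (auto simp: fun_pm_def abs_minus_commute)
  then show "\<exists>U. openin Z U \<and> a \<in> U \<and> (\<forall>x\<in>U. fun_pm Z f a x < \<epsilon>)"
    using U by blast
next
  fix x y assume "x \<in> topspace Z" "y \<in> topspace Z"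
  then show "fun_pm Z f x y \<le> 2 * B"
    using B[of x] B[of y] unfolding fun_pm_def by auto
qed (auto simp: fun_pm_def)

section \<open>Admissible metrics\<close>

lemma AM_PM: "d \<in> AM Z \<Longrightarrow> d \<in> PM Z"
  unfolding AM_def by blast

lemma AM_Metric_space: "d \<in> AM Z \<Longrightarrow> Metric_space (topspace Z) d"
  unfolding AM_def by blast

lemma AM_mtopology: "d \<in> AM Z \<Longrightarrow> Metric_space.mtopology (topspace Z) d = Z"
  unfolding AM_def by blast

lemma AM_pos:
  assumes "d \<in> AM Z" "x \<in> topspace Z" "y \<in> topspace Z" "x \<noteq> y" shows "d x y > 0"
  using Metric_space.mdist_pos_less[OF AM_Metric_space] assms by metis

lemma AM_openin:
  assumes d: "d \<in> AM Z"
  shows "openin Z U \<longleftrightarrow>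
    U \<subseteq> topspace Z \<and> (\<forall>x\<in>U. \<exists>r>0. \<forall>y\<in>topspace Z. d x y < r \<longrightarrow> y \<in> U)"
proof -
  interpret Metric_space "topspace Z" d by (rule AM_Metric_space[OF d])
  show ?thesis
    unfolding openin_mtopology[unfolded AM_mtopology[OF d]] subset_iff in_mball by blast
qed

lemma AM_I:
  assumes d: "d \<in> PM Z"
    and pos: "\<And>x y. x \<in> topspace Z \<Longrightarrow> y \<in> topspace Z \<Longrightarrow> x \<noteq> y \<Longrightarrow> d x y \<noteq> 0"
    and open_ball: "\<And>x U. openin Z U \<Longrightarrow> x \<in> U \<Longrightarrow> \<exists>r>0. \<forall>y\<in>topspace Z. d x y < r \<longrightarrow> y \<in> U"
  shows "d \<in> AM Z"
proof -
  interpret Metric_space "topspace Z" d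
    using PM_nonneg[OF d] PM_commute[OF d] PM_refl[OF d] PM_triangle[OF d] pos
    by unfold_locales metis+
  have "openin mtopology U \<longleftrightarrow> openin Z U" for U
  proof
    assume U: "openin Z U"
    then show "openin mtopology U"
      using open_ball[OF U] openin_subset[OF U] unfolding openin_mtopology subset_iff in_mball
      by blast
  next
    assume U: "openin mtopology U"
    show "openin Z U"
    proof (subst openin_subopen, intro ballI)
      fix x assume x: "x \<in> U"
      obtain r where r: "r > 0" "mball x r \<subseteq> U"
        using U x unfolding openin_mtopology by blast
      have xZ: "x \<in> topspace Z" using U x unfolding openin_mtopology by blast
      obtain V where V: "openin Z V" "x \<in> V" "\<And>y. y \<in> V \<Longrightarrow> d x y < r"
        using PM_small_nhd[OF d xZ r(1)] by blast
      have "V \<subseteq> U"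
        using r(2) V(3) xZ openin_subset[OF V(1)] by (auto simp: subset_iff)
      then show "\<exists>T. openin Z T \<and> x \<in> T \<and> T \<subseteq> U" using V by blast
    qed
  qed
  then have "mtopology = Z" by (simp add: topology_eq)
  then show ?thesis
    unfolding AM_def using d Metric_space_axioms by blast
qed

text \<open>
The balls of \<open>d\<close> are contained in those of \<open>c \<sigma>\<close>, so \<open>d\<close> induces at least the given topology, and its
continuity gives the other inclusion. Adding a pseudometric to an admissible metric therefore stays
inside \<^const>\<open>AM\<close>, which is what the perturbations in the density argument rely on.
\<close>

lemma AM_mono:
  assumes \<sigma>: "\<sigma> \<in> AM Z" and d: "d \<in> PM Z" and c: "c > 0"
    and ge: "\<And>x y. x \<in> topspace Z \<Longrightarrow> y \<in> topspace Z \<Longrightarrow> c * \<sigma> x y \<le> d x y"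
  shows "d \<in> AM Z"
proof (rule AM_I[OF d])
  fix x y assume "x \<in> topspace Z" "y \<in> topspace Z" "x \<noteq> y"
  then show "d x y \<noteq> 0"
    using AM_pos[OF \<sigma>, of x y] ge[of x y] mult_pos_pos[OF c] by fastforce
next
  fix x U assume U: "openin Z U" and x: "x \<in> U"
  then obtain r where r: "r > 0" "\<forall>y\<in>topspace Z. \<sigma> x y < r \<longrightarrow> y \<in> U"
    using AM_openin[OF \<sigma>] by metis
  have xZ: "x \<in> topspace Z" using U x openin_subset by blast
  have "y \<in> U" if y: "y \<in> topspace Z" "d x y < c * r" for y
  proof -
    have "c * \<sigma> x y < c * r" using ge[OF xZ y(1)] y(2) by linarith
    then show ?thesis using r(2) y(1) c by simp
  qed
  then show "\<exists>r>0. \<forall>y\<in>topspace Z. d x y < r \<longrightarrow> y \<in> U"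
    using r(1) c by (intro exI[of _ "c * r"]) auto
qed

lemma AM_nonempty:
  assumes "metrizable_space Z"
  obtains \<sigma> where "\<sigma> \<in> AM Z"
proof -
  obtain M d where "Metric_space M d" and Z: "Z = Metric_space.mtopology M d"
    using assms unfolding metrizable_space_def by blast
  interpret Metric_space M d by fact
  have [simp]: "topspace Z = M" by (simp add: Z)
  define \<sigma> where "\<sigma> = (\<lambda>x y. if x \<in> M \<and> y \<in> M then min 1 (d x y) else 0)"
  have PM: "\<sigma> \<in> PM Z"
  proof (rule PM_I[where B = 1])
    fix a and \<epsilon> :: real assume a: "a \<in> topspace Z" "\<epsilon> > 0"
    have "\<forall>x\<in>mball a \<epsilon>. \<sigma> a x < \<epsilon>" by (auto simp: \<sigma>_def)
    then show "\<exists>U. openin Z U \<and> a \<in> U \<and> (\<forall>x\<in>U. \<sigma> a x < \<epsilon>)"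
      using a Z by (intro exI[of _ "mball a \<epsilon>"]) auto
  next
    fix x y z assume "x \<in> topspace Z" "y \<in> topspace Z" "z \<in> topspace Z"
    then show "\<sigma> x z \<le> \<sigma> x y + \<sigma> y z"
      using triangle[of x y z] nonneg[of x y] nonneg[of y z]
      by (simp add: \<sigma>_def min_def del: nonneg)
  qed (auto simp: \<sigma>_def commute)
  have "\<sigma> \<in> AM Z"
  proof (rule AM_I[OF PM])
    fix x U assume U: "openin Z U" and x: "x \<in> U"
    then obtain r where r: "r > 0" "mball x r \<subseteq> U"
      unfolding Z openin_mtopology by blast
    have "x \<in> M" using U x openin_subset by fastforce
    then have "y \<in> U" if "y \<in> topspace Z" "\<sigma> x y < min 1 r" for y
      using that r(2) by (auto simp: \<sigma>_def subset_iff)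
    then show "\<exists>r>0. \<forall>y\<in>topspace Z. \<sigma> x y < r \<longrightarrow> y \<in> U"
      using r(1) by (intro exI[of _ "min 1 r"]) auto
  qed (auto simp: \<sigma>_def min_def)
  then show ?thesis using that by blast
qed

section \<open>The sup-metric and the norm\<close>

lemma pm_dist_upper:
  assumes d: "d \<in> PM Z" and e: "e \<in> PM Z" and x: "x \<in> topspace Z" "y \<in> topspace Z"
  shows "\<bar>d x y - e x y\<bar> \<le> pm_dist Z d e"
proof -
  obtain B where B: "\<And>x y. d x y \<le> B" using PM_bounded[OF d] by metis
  obtain C where C: "\<And>x y. e x y \<le> C" using PM_bounded[OF e] by metis
  have "\<bar>d u v - e u v\<bar> \<le> B + C" for u v
    using B[of u v] C[of u v] PM_nonneg[OF d, of u v] PM_nonneg[OF e, of u v] by linarith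
  then have "bdd_above ((\<lambda>(z, w). \<bar>d z w - e z w\<bar>) ` (topspace Z \<times> topspace Z))"
    by (intro bdd_aboveI[of _ "B + C"]) auto
  then have "(case (x, y) of (z, w) \<Rightarrow> \<bar>d z w - e z w\<bar>) \<le> pm_dist Z d e"
    unfolding pm_dist_def using x by (intro cSUP_upper) auto
  then show ?thesis by simp
qed

lemma pm_dist_least:
  assumes "topspace Z \<noteq> {}"
    and "\<And>x y. x \<in> topspace Z \<Longrightarrow> y \<in> topspace Z \<Longrightarrow> \<bar>d x y - e x y\<bar> \<le> c"
  shows "pm_dist Z d e \<le> c"
  unfolding pm_dist_def using assms by (intro cSUP_least) auto

lemma pm_dist_approx:
  assumes "topspace Z \<noteq> {}" "c < pm_dist Z d e"
  obtains x y where "x \<in> topspace Z" "y \<in> topspace Z" "c < \<bar>d x y - e x y\<bar>"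
  using pm_dist_least[OF assms(1), of d e c] assms(2) by (meson linorder_not_le)

lemma pm_norm_upper:
  assumes d: "d \<in> PM Z" and x: "x \<in> topspace Z" "y \<in> topspace Z"
  shows "d x y \<le> pm_norm Z d"
proof -
  obtain B where B: "\<And>x y. d x y \<le> B" using PM_bounded[OF d] by metis
  then have "bdd_above ((\<lambda>(z, w). d z w) ` (topspace Z \<times> topspace Z))"
    by (intro bdd_aboveI[of _ B]) auto
  then have "(case (x, y) of (z, w) \<Rightarrow> d z w) \<le> pm_norm Z d"
    unfolding pm_norm_def using x by (intro cSUP_upper) auto
  then show ?thesis by simp
qed

lemma pm_norm_least:
  assumes "topspace Z \<noteq> {}"
    and "\<And>x y. x \<in> topspace Z \<Longrightarrow> y \<in> topspace Z \<Longrightarrow> d x y \<le> c"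
  shows "pm_norm Z d \<le> c"
  unfolding pm_norm_def using assms by (intro cSUP_least) auto

lemma pm_dist_commute: "pm_dist Z d e = pm_dist Z e d"
  unfolding pm_dist_def by (simp add: abs_minus_commute)

lemma pm_dist_nonneg:
  assumes "topspace Z \<noteq> {}" "d \<in> PM Z" "e \<in> PM Z" shows "0 \<le> pm_dist Z d e"
proof -
  obtain x where "x \<in> topspace Z" using assms(1) by blast
  then show ?thesis using pm_dist_upper[OF assms(2,3), of x x] by linarith
qed

lemma pm_dist_self: "topspace Z \<noteq> {} \<Longrightarrow> pm_dist Z d d = 0"
  unfolding pm_dist_def by (simp add: case_prod_unfold)

lemma pm_dist_triangle:
  assumes Z: "topspace Z \<noteq> {}" and d: "d \<in> PM Z" and e: "e \<in> PM Z" and f: "f \<in> PM Z"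
  shows "pm_dist Z d f \<le> pm_dist Z d e + pm_dist Z e f"
proof (rule pm_dist_least[OF Z])
  fix x y assume "x \<in> topspace Z" "y \<in> topspace Z"
  then show "\<bar>d x y - f x y\<bar> \<le> pm_dist Z d e + pm_dist Z e f"
    using pm_dist_upper[OF d e, of x y] pm_dist_upper[OF e f, of x y] by linarith
qed

lemma pm_dist_zero_imp_eq:
  assumes d: "d \<in> PM Z" and e: "e \<in> PM Z" and 0: "pm_dist Z d e = 0"
  shows "d = e"
proof (rule PM_eqI[OF d e])
  fix x y assume "x \<in> topspace Z" "y \<in> topspace Z"
  then show "d x y = e x y" using pm_dist_upper[OF d e, of x y] 0 by simp
qed

section \<open>Pseudometrics peaking at a pair of points\<close>

text \<open>
A positive bump of height \<open>s\<close> at \<open>a\<close> and a negative one at \<open>b\<close>. When \<open>s < \<sigma> a b\<close> the balls of radius \<open>s / 2\<close>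
that support the bumps are disjoint, so the oscillation of this function between \<open>a\<close> and \<open>b\<close> is \<open>2 s\<close>,
and between any two points that do not lie in different bumps it is at most \<open>s\<close>. The slope \<open>2\<close>
matters: it makes the oscillation drop faster than \<open>\<sigma>\<close> itself can grow when \<open>(x, y)\<close> moves away
from \<open>(a, b)\<close>, so that the peak survives adding \<open>\<sigma>\<close>.
\<close>

definition peak_fun :: "('a \<Rightarrow> 'a \<Rightarrow> real) \<Rightarrow> real \<Rightarrow> 'a \<Rightarrow> 'a \<Rightarrow> 'a \<Rightarrow> real" where
  "peak_fun \<sigma> s a b x = max 0 (s - 2 * \<sigma> x a) - max 0 (s - 2 * \<sigma> x b)"

lemma peak_fun_PM:
  assumes \<sigma>: "\<sigma> \<in> PM Z" and "a \<in> topspace Z" "b \<in> topspace Z" and s: "s > 0"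
  shows "fun_pm Z (peak_fun \<sigma> s a b) \<in> PM Z"
proof (rule fun_pm_in_PM[where B = s])
  show "continuous_map Z euclideanreal (peak_fun \<sigma> s a b)"
    unfolding peak_fun_def[abs_def] using assms
    by (intro continuous_intros PM_continuous_map' continuous_map_real_mult_left) auto
  show "\<bar>peak_fun \<sigma> s a b x\<bar> \<le> s" for x
    using PM_nonneg[OF \<sigma>, of x a] PM_nonneg[OF \<sigma>, of x b] s unfolding peak_fun_def by auto
qed

lemma peak_fun_sandwich:
  assumes \<sigma>: "\<sigma> \<in> PM Z" and Z: "a \<in> topspace Z" "b \<in> topspace Z" "x \<in> topspace Z" "y \<in> topspace Z"
    and s: "0 < s" "s < \<sigma> a b"
  shows "fun_pm Z (peak_fun \<sigma> s a b) x y \<le> s \<or>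
     fun_pm Z (peak_fun \<sigma> s a b) x y = 2 * s - 2 * \<sigma> x a - 2 * \<sigma> y b \<or>
     fun_pm Z (peak_fun \<sigma> s a b) x y = 2 * s - 2 * \<sigma> y a - 2 * \<sigma> x b"
proof -
  have "\<sigma> a b \<le> \<sigma> x a + \<sigma> x b" "\<sigma> a b \<le> \<sigma> y a + \<sigma> y b"
    using PM_triangle[OF \<sigma>, of a x b] PM_triangle[OF \<sigma>, of a y b] PM_commute[OF \<sigma>, of a x]
      PM_commute[OF \<sigma>, of a y] Z by auto
  then show ?thesis
    using s Z PM_nonneg[OF \<sigma>, of x a] PM_nonneg[OF \<sigma>, of x b] PM_nonneg[OF \<sigma>, of y a]
      PM_nonneg[OF \<sigma>, of y b]
    unfolding fun_pm_def peak_fun_def max_def abs_if by auto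
qed

lemma peak_fun_at:
  assumes \<sigma>: "\<sigma> \<in> PM Z" and Z: "a \<in> topspace Z" "b \<in> topspace Z"
    and s: "0 < s" "s < \<sigma> a b"
  shows "fun_pm Z (peak_fun \<sigma> s a b) a b = 2 * s"
  using s Z PM_refl[OF \<sigma>] PM_commute[OF \<sigma>, of a b]
  unfolding fun_pm_def peak_fun_def max_def by auto

text \<open>
The oscillation of the two bumps approaches its maximum only near \<open>(a, b)\<close> and \<open>(b, a)\<close>. The last
property says that with no mention of neighbourhoods: if \<open>p\<close> is almost maximal at \<open>(x, y)\<close>, then every
other pseudometric takes almost the same value at \<open>(x, y)\<close> as at \<open>(a, b)\<close>. In this form the peak can
be transported through an isometry, which knows nothing about points.
\<close>

lemma strongly_peaking_pseudometric:
  assumes mz: "metrizable_space Z" and ab: "a \<in> topspace Z" "b \<in> topspace Z" "a \<noteq> b"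
  obtains p where "p \<in> PM Z" "p a b = 1" "\<And>x y. x \<in> topspace Z \<Longrightarrow> y \<in> topspace Z \<Longrightarrow> p x y \<le> 1"
    "\<And>e \<epsilon>. e \<in> PM Z \<Longrightarrow> \<epsilon> > 0 \<Longrightarrow>
       \<exists>\<delta>>0. \<forall>x\<in>topspace Z. \<forall>y\<in>topspace Z. 1 - \<delta> < p x y \<longrightarrow> \<bar>e x y - e a b\<bar> < \<epsilon>"
proof -
  obtain \<sigma> where \<sigma>: "\<sigma> \<in> AM Z" using AM_nonempty[OF mz] by blast
  note \<sigma>P = AM_PM[OF \<sigma>]
  define s where "s = \<sigma> a b / 2"
  have s: "0 < s" "s < \<sigma> a b"
    using AM_pos[OF \<sigma> ab] by (auto simp: s_def)
  define F where "F = fun_pm Z (peak_fun \<sigma> s a b)"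
  have F: "F \<in> PM Z" unfolding F_def using peak_fun_PM[OF \<sigma>P ab(1,2) s(1)] .
  define p where "p = (\<lambda>x y. 1 / (2 * s) * F x y)"
  have pF: "p x y = F x y / (2 * s)" for x y by (simp add: p_def)
  have sandwich: "F x y \<le> s \<or> F x y = 2 * s - 2 * \<sigma> x a - 2 * \<sigma> y b \<or> F x y = 2 * s - 2 * \<sigma> y a - 2 * \<sigma> x b"
    if "x \<in> topspace Z" "y \<in> topspace Z" for x y
    using peak_fun_sandwich[OF \<sigma>P ab(1,2) that s] unfolding F_def .
  show ?thesis
  proof
    show "p \<in> PM Z" unfolding p_def using PM_scale[OF F, of "1 / (2 * s)"] s by simp
    show "p a b = 1" using peak_fun_at[OF \<sigma>P ab(1,2) s] s by (simp add: pF F_def)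
    show "p x y \<le> 1" if "x \<in> topspace Z" "y \<in> topspace Z" for x y
      using sandwich[OF that] s PM_nonneg[OF \<sigma>P, of x a] PM_nonneg[OF \<sigma>P, of x b]
        PM_nonneg[OF \<sigma>P, of y a] PM_nonneg[OF \<sigma>P, of y b] by (auto simp: pF)
    fix e and \<epsilon> :: real assume e: "e \<in> PM Z" and \<epsilon>: "\<epsilon> > 0"
    have near: "\<exists>r>0. \<forall>x\<in>topspace Z. \<sigma> c x < r \<longrightarrow> e c x < \<epsilon>/2" if c: "c \<in> topspace Z" for c
    proof -
      obtain U where U: "openin Z U" "c \<in> U" "\<And>x. x \<in> U \<Longrightarrow> e c x < \<epsilon>/2"
        using PM_small_nhd[OF e c, of "\<epsilon>/2"] \<epsilon> by (metis half_gt_zero)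
      then show ?thesis using AM_openin[OF \<sigma>, of U] by blast
    qed
    obtain r1 where r1: "r1 > 0" "\<forall>x\<in>topspace Z. \<sigma> a x < r1 \<longrightarrow> e a x < \<epsilon>/2"
      using near[OF ab(1)] by blast
    obtain r2 where r2: "r2 > 0" "\<forall>x\<in>topspace Z. \<sigma> b x < r2 \<longrightarrow> e b x < \<epsilon>/2"
      using near[OF ab(2)] by blast
    define r where "r = min s (min r1 r2)"
    have r: "r > 0" "r \<le> s" "r \<le> r1" "r \<le> r2" using r1 r2 s by (auto simp: r_def)
    have "\<bar>e x y - e a b\<bar> < \<epsilon>"
      if xy: "x \<in> topspace Z" "y \<in> topspace Z" and p: "1 - r / (2 * s) < p x y" for x y
    proof -
      have "(1 - r / (2 * s)) * (2 * s) < F x y / (2 * s) * (2 * s)"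
        using p s by (intro mult_strict_right_mono) (auto simp: pF)
      then have Fxy: "F x y > 2 * s - r" using s by (simp add: left_diff_distrib)
      have close: "\<bar>e u v - e a b\<bar> < \<epsilon>"
        if uv: "u \<in> topspace Z" "v \<in> topspace Z" and "2 * s - r < 2 * s - 2 * \<sigma> u a - 2 * \<sigma> v b" for u v
      proof -
        have "\<sigma> a u < r" "\<sigma> b v < r"
          using that PM_nonneg[OF \<sigma>P, of a u] PM_nonneg[OF \<sigma>P, of b v] PM_commute[OF \<sigma>P, of a u]
            PM_commute[OF \<sigma>P, of b v] by linarith+
        then have "e a u < \<epsilon>/2" "e b v < \<epsilon>/2" using r1(2) r2(2) r uv by auto
        then show ?thesis using PM_quad[OF e uv ab(1,2)] by linarith
      qed
      have "2 * s - r < 2 * s - 2 * \<sigma> x a - 2 * \<sigma> y b \<or> 2 * s - r < 2 * s - 2 * \<sigma> y a - 2 * \<sigma> x b"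
        using sandwich[OF xy] Fxy r by linarith
      then show ?thesis
        using close[OF xy] close[OF xy(2,1)] PM_commute[OF e, of x y] by auto
    qed
    then show "\<exists>\<delta>>0. \<forall>x\<in>topspace Z. \<forall>y\<in>topspace Z. 1 - \<delta> < p x y \<longrightarrow> \<bar>e x y - e a b\<bar> < \<epsilon>"
      using r s by (intro exI[of _ "r / (2 * s)"]) auto
  qed
qed

section \<open>Isometries and evaluation at a pair of points\<close>

lemma isometry_dist:
  "pm_isometry X A Y B T \<Longrightarrow> d \<in> A \<Longrightarrow> d' \<in> A \<Longrightarrow> pm_dist Y (T d) (T d') = pm_dist X d d'"
  unfolding pm_isometry_def by blast

lemma isometry_in: "pm_isometry X A Y B T \<Longrightarrow> d \<in> A \<Longrightarrow> T d \<in> B"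
  unfolding pm_isometry_def by blast

lemma isometry_inj:
  assumes T: "pm_isometry X A Y B T" and "A \<subseteq> PM X" "topspace Y \<noteq> {}"
  shows "inj_on T A"
proof (rule inj_onI)
  fix d e assume de: "d \<in> A" "e \<in> A" "T d = T e"
  then have "pm_dist X d e = 0"
    using isometry_dist[OF T de(1,2)] pm_dist_self[OF assms(3)] by simp
  then show "d = e" using pm_dist_zero_imp_eq[of d X e] de assms(2) by blast
qed

lemma isometry_inverse:
  assumes T: "pm_isometry X A Y B T" and A: "A \<subseteq> PM X" and Y: "topspace Y \<noteq> {}"
  shows "pm_isometry Y B X A (inv_into A T)"
    and "\<And>d. d \<in> A \<Longrightarrow> inv_into A T (T d) = d"
    and "\<And>q. q \<in> B \<Longrightarrow> T (inv_into A T q) = q"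
    and "\<And>q. q \<in> B \<Longrightarrow> inv_into A T q \<in> A"
proof -
  have TA: "T ` A = B" using T unfolding pm_isometry_def by blast
  note inj = isometry_inj[OF T A Y]
  show 1: "inv_into A T (T d) = d" if "d \<in> A" for d using inj that by simp
  show 2: "T (inv_into A T q) = q" if "q \<in> B" for q using TA that by (metis f_inv_into_f)
  show 3: "inv_into A T q \<in> A" if "q \<in> B" for q using TA that by (metis inv_into_into)
  have "inv_into A T ` B = A" using 1 3 TA by force
  then show "pm_isometry Y B X A (inv_into A T)"
    unfolding pm_isometry_def using isometry_dist[OF T] 2 3 by metis
qed

text \<open>
For large \<open>t\<close> the supremum of \<open>\<bar>t p - e\<bar>\<close> is forced towards the peak of \<open>p\<close>, where it is \<open>t - e a b\<close>.
Hence evaluation at the pair \<open>(a, b)\<close> is, up to sign, the Busemann function of the ray \<open>t p\<close>, a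
purely metric object. Only the upper estimate needs the peak; the lower one is evaluation at
\<open>(a, b)\<close>.
\<close>

lemma busemann_limit:
  assumes Z: "topspace Z \<noteq> {}" and ab: "a \<in> topspace Z" "b \<in> topspace Z"
    and p: "p \<in> PM Z" "\<And>x y. x \<in> topspace Z \<Longrightarrow> y \<in> topspace Z \<Longrightarrow> p x y \<le> 1"
    and peak: "\<And>e \<epsilon>. e \<in> PM Z \<Longrightarrow> \<epsilon> > 0 \<Longrightarrow>
       \<exists>\<delta>>0. \<forall>x\<in>topspace Z. \<forall>y\<in>topspace Z. 1 - \<delta> < p x y \<longrightarrow> \<bar>e x y - e a b\<bar> < \<epsilon>"
    and e: "e \<in> PM Z" and \<epsilon>: "\<epsilon> > 0"
  shows "\<forall>\<^sub>F t in at_top. pm_dist Z (\<lambda>x y. t * p x y) e \<le> t - e a b + \<epsilon>"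
proof -
  obtain B where B: "B > 0" "\<And>x y. e x y \<le> B" using PM_bounded[OF e] by metis
  obtain \<delta> where \<delta>: "\<delta> > 0"
    "\<And>x y. x \<in> topspace Z \<Longrightarrow> y \<in> topspace Z \<Longrightarrow> 1 - \<delta> < p x y \<Longrightarrow> \<bar>e x y - e a b\<bar> < \<epsilon>"
    using peak[OF e \<epsilon>] by blast
  show ?thesis
    using eventually_ge_at_top[of "2 * B"] eventually_ge_at_top[of "B / \<delta>"]
  proof eventually_elim
    case (elim t)
    have t: "t \<ge> 0" using elim B by linarith
    have tB: "B \<le> t * \<delta>" using elim \<delta> by (simp add: field_simps)
    show ?case
    proof (rule pm_dist_least[OF Z])
      fix x y assume xy: "x \<in> topspace Z" "y \<in> topspace Z"
      have e0: "0 \<le> e x y" "0 \<le> e a b" using PM_nonneg[OF e] by auto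
      have tp: "0 \<le> t * p x y" "t * p x y \<le> t"
        using t PM_nonneg[OF p(1), of x y] p(2)[OF xy] by (auto intro: mult_left_le)
      have up: "t * p x y - e x y \<le> t - e a b + \<epsilon>"
      proof (cases "1 - \<delta> < p x y")
        case True
        then show ?thesis using \<delta>(2)[OF xy True] tp by linarith
      next
        case False
        then have "t * p x y \<le> t * (1 - \<delta>)" using t by (intro mult_left_mono) auto
        then have "t * p x y \<le> t - t * \<delta>" by (simp add: algebra_simps)
        then show ?thesis using tB B(2)[of a b] e0 \<epsilon> by linarith
      qed
      have "e x y - t * p x y \<le> t - e a b + \<epsilon>"
        using tp B(2)[of x y] B(2)[of a b] elim \<epsilon> by linarith
      then show "\<bar>t * p x y - e x y\<bar> \<le> t - e a b + \<epsilon>" using up by linarith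
    qed
  qed
qed

text \<open>
The isometric image of the ray \<open>t p\<close> is a curve in \<open>PM Y\<close> with the same Busemann function. At time \<open>t\<close>
choose a pair \<open>(u, v)\<close> at which the distance from \<open>T (t p)\<close> to \<open>T e0\<close> is almost attained. The distance to
the other \<open>T e\<close> bounds \<open>T (t p) u v - T e u v\<close> from above, and subtracting the two estimates
eliminates the unknown value \<open>T (t p) u v\<close>.
\<close>

lemma isometry_transports_pair_from_base:
  assumes mX: "metrizable_space X" and Y: "topspace Y \<noteq> {}"
    and T: "pm_isometry X (PM X) Y (PM Y) T"
    and ab: "a \<in> topspace X" "b \<in> topspace X" "a \<noteq> b"
    and e0: "e0 \<in> PM X" and F: "finite F" "F \<subseteq> PM X" and \<epsilon>: "\<epsilon> > 0"
  obtains u v where "u \<in> topspace Y" "v \<in> topspace Y"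
    "\<And>e. e \<in> F \<Longrightarrow> e a b - e0 a b \<le> T e u v - T e0 u v + \<epsilon>"
proof -
  have X: "topspace X \<noteq> {}" using ab by blast
  obtain p where p: "p \<in> PM X" "p a b = 1"
      "\<And>x y. x \<in> topspace X \<Longrightarrow> y \<in> topspace X \<Longrightarrow> p x y \<le> 1"
    and peak: "\<And>e \<epsilon>. e \<in> PM X \<Longrightarrow> \<epsilon> > 0 \<Longrightarrow>
       \<exists>\<delta>>0. \<forall>x\<in>topspace X. \<forall>y\<in>topspace X. 1 - \<delta> < p x y \<longrightarrow> \<bar>e x y - e a b\<bar> < \<epsilon>"
    using strongly_peaking_pseudometric[OF mX ab] by blast
  obtain B where B: "\<And>x y. T e0 x y \<le> B" using PM_bounded[OF isometry_in[OF T e0]] by metis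
  have \<epsilon>2: "\<epsilon> / 2 > 0" using \<epsilon> by simp
  have "\<forall>e\<in>F. \<forall>\<^sub>F t in at_top. pm_dist X (\<lambda>x y. t * p x y) e \<le> t - e a b + \<epsilon> / 2"
    using busemann_limit[OF X ab(1,2) p(1,3) peak _ \<epsilon>2] F(2) by blast
  then have "\<forall>\<^sub>F t in at_top. \<forall>e\<in>F. pm_dist X (\<lambda>x y. t * p x y) e \<le> t - e a b + \<epsilon> / 2"
    using F(1) by (simp add: eventually_ball_finite_distrib)
  then obtain t where t: "\<And>e. e \<in> F \<Longrightarrow> pm_dist X (\<lambda>x y. t * p x y) e \<le> t - e a b + \<epsilon> / 2"
      "t > B + e0 a b + \<epsilon>" "t \<ge> 0"
    using eventually_happens[OF eventually_conj[OF _ eventually_conj[OF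
          eventually_gt_at_top[of "B + e0 a b + \<epsilon>"] eventually_ge_at_top[of 0]]]] by force
  define g where "g = (\<lambda>x y. t * p x y)"
  have g: "g \<in> PM X" unfolding g_def using PM_scale[OF p(1) t(3)] .
  have "t - e0 a b \<le> pm_dist Y (T g) (T e0)"
    using pm_dist_upper[OF g e0 ab(1,2)] p(2) isometry_dist[OF T g e0] by (simp add: g_def)
  then have "t - e0 a b - \<epsilon> / 2 < pm_dist Y (T g) (T e0)" using \<epsilon> by linarith
  then obtain u v where uv: "u \<in> topspace Y" "v \<in> topspace Y"
      "t - e0 a b - \<epsilon> / 2 < \<bar>T g u v - T e0 u v\<bar>"
    using pm_dist_approx[OF Y] by blast
  \<comment> \<open>As \<open>T g\<close> is non-negative and \<open>t\<close> exceeds the bound of \<open>T e0\<close>, the difference is attained with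
    the positive sign.\<close>
  have "T e0 u v - T g u v \<le> B"
    using B[of u v] PM_nonneg[OF isometry_in[OF T g], of u v] by linarith
  then have sign: "t - e0 a b - \<epsilon> / 2 < T g u v - T e0 u v" using uv(3) t(2) \<epsilon> by linarith
  have "e a b - e0 a b \<le> T e u v - T e0 u v + \<epsilon>" if e: "e \<in> F" for e
  proof -
    have eP: "e \<in> PM X" using e F by blast
    have "\<bar>T g u v - T e u v\<bar> \<le> t - e a b + \<epsilon> / 2"
      using pm_dist_upper[OF isometry_in[OF T g] isometry_in[OF T eP] uv(1,2)]
        isometry_dist[OF T g eP] t(1)[OF e] by (simp add: g_def)
    then show ?thesis using sign by linarith
  qed
  then show ?thesis using that uv by blast
qed

text \<open>
The one-sided estimates for \<open>T\<close> and for its inverse close up. Going from \<open>(a, b)\<close> to a pair \<open>(u, v)\<close> of \<open>Y\<close>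
and back to a pair \<open>(x, y)\<close> of \<open>X\<close> gives \<open>e a b \<le> T e u v - T 0 u v + \<kappa> \<le> e x y + 2 \<kappa>\<close> for all \<open>e\<close> in a
finite set. Put a strongly peaking \<open>p\<close> into that set: then \<open>p x y\<close> is almost maximal, which
forces \<open>e x y\<close> back to \<open>e a b\<close>. Putting the preimage of \<open>0\<close> into the set removes the term \<open>T 0 u v\<close>.
\<close>

lemma isometry_approximates_pair:
  assumes mX: "metrizable_space X" and mY: "metrizable_space Y"
    and T: "pm_isometry X (PM X) Y (PM Y) T" and Y: "topspace Y \<noteq> {}"
    and ab: "a \<in> topspace X" "b \<in> topspace X" "a \<noteq> b"
    and F: "finite F" "F \<subseteq> PM X" and \<epsilon>: "\<epsilon> > 0"
  obtains u v where "u \<in> topspace Y" "v \<in> topspace Y" "\<And>e. e \<in> F \<Longrightarrow> \<bar>T e u v - e a b\<bar> \<le> \<epsilon>"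
proof -
  have X: "topspace X \<noteq> {}" using ab by blast
  define S where "S = inv_into (PM X) T"
  note S = isometry_inverse[OF T subset_refl Y, folded S_def]
  obtain p where p: "p \<in> PM X" "p a b = 1"
      "\<And>x y. x \<in> topspace X \<Longrightarrow> y \<in> topspace X \<Longrightarrow> p x y \<le> 1"
    and peak: "\<And>e \<epsilon>. e \<in> PM X \<Longrightarrow> \<epsilon> > 0 \<Longrightarrow>
       \<exists>\<delta>>0. \<forall>x\<in>topspace X. \<forall>y\<in>topspace X. 1 - \<delta> < p x y \<longrightarrow> \<bar>e x y - e a b\<bar> < \<epsilon>"
    using strongly_peaking_pseudometric[OF mX ab] by blast
  define z where "z = (\<lambda>(x::'a) (y::'a). 0::real)"
  have z: "z \<in> PM X" unfolding z_def by (rule PM_zero)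
  define n where "n = S (\<lambda>x y. 0)"
  have n: "n \<in> PM X" "T n = (\<lambda>x y. 0)" unfolding n_def using S(3,4)[OF PM_zero] by auto
  define G where "G = insert p (insert n F)"
  have G: "finite G" "G \<subseteq> PM X" using F p n by (auto simp: G_def)
  have \<epsilon>4: "\<epsilon> / 4 > 0" using \<epsilon> by simp
  have "\<forall>e\<in>G. \<forall>\<^sub>F \<delta> in at_right 0. \<forall>x\<in>topspace X. \<forall>y\<in>topspace X.
          1 - \<delta> < p x y \<longrightarrow> \<bar>e x y - e a b\<bar> < \<epsilon> / 4"
  proof
    fix e assume "e \<in> G"
    then obtain \<delta> where "\<delta> > 0" and
      \<delta>: "\<forall>x\<in>topspace X. \<forall>y\<in>topspace X. 1 - \<delta> < p x y \<longrightarrow> \<bar>e x y - e a b\<bar> < \<epsilon> / 4"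
      using peak[OF _ \<epsilon>4] G(2) by blast
    have "\<forall>\<^sub>F \<delta>' in at_right 0. \<delta>' < \<delta>"
      using \<open>\<delta> > 0\<close> by (auto simp: eventually_at_right_field)
    then show "\<forall>\<^sub>F \<delta> in at_right 0. \<forall>x\<in>topspace X. \<forall>y\<in>topspace X.
          1 - \<delta> < p x y \<longrightarrow> \<bar>e x y - e a b\<bar> < \<epsilon> / 4"
      by eventually_elim (use \<delta> in force)
  qed
  then have "\<forall>\<^sub>F \<delta> in at_right 0. \<forall>e\<in>G. \<forall>x\<in>topspace X. \<forall>y\<in>topspace X.
          1 - \<delta> < p x y \<longrightarrow> \<bar>e x y - e a b\<bar> < \<epsilon> / 4"
    using G(1) by (simp add: eventually_ball_finite_distrib)
  then obtain \<delta> where "\<delta> > 0" and \<delta>: "\<And>e x y. e \<in> G \<Longrightarrow> x \<in> topspace X \<Longrightarrow> y \<in> topspace X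
      \<Longrightarrow> 1 - \<delta> < p x y \<Longrightarrow> \<bar>e x y - e a b\<bar> < \<epsilon> / 4"
    by (auto simp: eventually_at_right_field dest: dense)
  \<comment> \<open>The bound \<open>\<kappa> < 1\<close> keeps \<open>(u, v)\<close> off the diagonal, and \<open>2 \<kappa> < \<delta>\<close> makes \<open>p x y\<close> almost maximal.\<close>
  define \<kappa> where "\<kappa> = min (1/2) (min (\<epsilon> / 8) (\<delta> / 4))"
  have \<kappa>: "\<kappa> > 0" "\<kappa> < 1" "\<kappa> \<le> \<epsilon> / 8" "2 * \<kappa> < \<delta>" using \<epsilon> \<open>\<delta> > 0\<close> by (auto simp: \<kappa>_def min_def)
  obtain u v where uv: "u \<in> topspace Y" "v \<in> topspace Y"
    and low: "\<And>e. e \<in> G \<Longrightarrow> e a b - z a b \<le> T e u v - T z u v + \<kappa>"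
    using isometry_transports_pair_from_base[OF mX Y T ab z G \<kappa>(1)] by blast
  have TzP: "T z \<in> PM Y" using isometry_in[OF T z] .
  have "u \<noteq> v"
  proof
    assume "u = v"
    then have "T p u v = 0" "T z u v = 0" using PM_refl[OF TzP] PM_refl[OF isometry_in[OF T p(1)]] by auto
    then show False using low[of p] p(2) \<kappa>(2) by (simp add: G_def z_def)
  qed
  have TG: "finite (T ` G)" "T ` G \<subseteq> PM Y" using G isometry_in[OF T] by auto
  obtain x y where xy: "x \<in> topspace X" "y \<in> topspace X"
    and "\<And>q. q \<in> T ` G \<Longrightarrow> q u v - T z u v \<le> S q x y - S (T z) x y + \<kappa>"
    using isometry_transports_pair_from_base[OF mY X S(1) uv \<open>u \<noteq> v\<close> TzP TG \<kappa>(1)] by blast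
  then have "T e u v - T z u v \<le> S (T e) x y - S (T z) x y + \<kappa>" if "e \<in> G" for e
    using that by blast
  then have up: "T e u v - T z u v \<le> e x y + \<kappa>" if "e \<in> G" for e
    using that S(2)[of e] S(2)[OF z] G(2) by (force simp: z_def)
  have "p x y \<ge> 1 - 2 * \<kappa>"
    using low[of p] up[of p] p(2) by (simp add: G_def z_def)
  then have px: "1 - \<delta> < p x y" using \<kappa>(4) by linarith
  have Tz: "0 \<le> T z u v" "T z u v \<le> \<kappa>"
    using PM_nonneg[OF TzP, of u v] low[of n] n(2) PM_nonneg[OF n(1), of a b]
    by (auto simp: G_def z_def)
  have "\<bar>T e u v - e a b\<bar> \<le> \<epsilon>" if "e \<in> F" for e
  proof -
    have eG: "e \<in> G" using that by (simp add: G_def)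
    show ?thesis
      using low[OF eG] up[OF eG] \<delta>[OF eG xy px] Tz \<kappa>(1,3) \<epsilon> unfolding z_def by linarith
  qed
  then show ?thesis using that uv by blast
qed

section \<open>Sequences of pairs that converge under every pseudometric\<close>

lemma strict_mono_selection:
  fixes P :: "nat \<Rightarrow> nat \<Rightarrow> bool"
  assumes "\<And>k N. \<exists>n>N. P k n"
  obtains r where "strict_mono r" "\<And>k. P k (r k)"
proof -
  have "\<exists>r. \<forall>k. P k (r k) \<and> r k < r (Suc k)"
    by (rule dependent_nat_choice) (use assms in blast)+
  then show ?thesis using that by (auto simp: strict_mono_Suc_iff)
qed

lemma no_convergent_subsequence_away:
  assumes \<sigma>: "\<sigma> \<in> AM Z" and w: "\<And>n. w n \<in> topspace Z" and l: "l \<in> topspace Z"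
    and no: "\<nexists>r. strict_mono (r :: nat \<Rightarrow> nat) \<and> limitin Z (w \<circ> r) l sequentially"
  obtains \<epsilon> where "\<epsilon> > 0" "\<forall>\<^sub>F n in sequentially. \<epsilon> \<le> \<sigma> l (w n)"
proof (rule ccontr)
  assume "\<not> thesis"
  then have "\<exists>n>N. \<sigma> l (w n) < 1 / Suc k" for k N
    using that[of "1 / Suc k"] unfolding eventually_sequentially
    by (metis Suc_le_eq linorder_not_le of_nat_0_less_iff zero_less_Suc zero_less_divide_1_iff)
  then obtain r where r: "strict_mono r" "\<And>k. \<sigma> l (w (r k)) < 1 / Suc k"
    using strict_mono_selection[of "\<lambda>k n. \<sigma> l (w n) < 1 / Suc k"] by blast
  have "limitin Z (w \<circ> r) l sequentially"
    unfolding limitin_def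
  proof (intro conjI allI impI l)
    fix U assume U: "openin Z U \<and> l \<in> U"
    then obtain \<epsilon> where \<epsilon>: "\<epsilon> > 0" "\<forall>y\<in>topspace Z. \<sigma> l y < \<epsilon> \<longrightarrow> y \<in> U"
      using AM_openin[OF \<sigma>, of U] by blast
    have "\<forall>\<^sub>F k in sequentially. 1 / real (Suc k) < \<epsilon>"
      using order_tendstoD(2)[OF LIMSEQ_inverse_real_of_nat \<epsilon>(1)] by (simp add: inverse_eq_divide)
    then show "\<forall>\<^sub>F k in sequentially. (w \<circ> r) k \<in> U"
    proof eventually_elim
      case (elim k)
      then have "\<sigma> l (w (r k)) < \<epsilon>" using r(2)[of k] by linarith
      then show ?case using \<epsilon>(2) w by simp
    qed
  qed
  then show False using no r(1) by blast
qed

lemma away_not_in_closure: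
  assumes \<sigma>: "\<sigma> \<in> AM Z" and w: "\<And>n. w n \<in> topspace Z" and l: "l \<in> topspace Z"
    and \<epsilon>: "\<epsilon> > 0" "\<forall>\<^sub>F n in sequentially. \<epsilon> \<le> \<sigma> l (w n)"
    and ne: "\<And>n. n \<in> N \<Longrightarrow> w n \<noteq> l"
  shows "l \<notin> Z closure_of (w ` N)"
proof -
  interpret Metric_space "topspace Z" \<sigma> by (rule AM_Metric_space[OF \<sigma>])
  obtain m where m: "\<And>n. n \<ge> m \<Longrightarrow> \<epsilon> \<le> \<sigma> l (w n)"
    using \<epsilon>(2) unfolding eventually_sequentially by blast
  define D where "D = insert \<epsilon> ((\<lambda>n. \<sigma> l (w n)) ` (N \<inter> {..<m}))"
  have "0 < \<sigma> l (w n)" if "n \<in> N" for n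
    using mdist_pos_less[of l "w n"] ne[OF that] w l by metis
  then have D: "finite D" "D \<noteq> {}" "\<And>x. x \<in> D \<Longrightarrow> x > 0"
    using \<epsilon>(1) unfolding D_def by blast+
  have "Min D \<le> \<sigma> l (w n)" if "n \<in> N" for n
  proof (cases "n < m")
    case True
    then show ?thesis using that D(1) by (intro Min_le) (auto simp: D_def)
  next
    case False
    have "Min D \<le> \<epsilon>" using D(1) by (intro Min_le) (auto simp: D_def)
    then show ?thesis using m[of n] False by linarith
  qed
  moreover have "Min D > 0" using D by simp
  ultimately show ?thesis
    using metric_closure_of[of "w ` N"] unfolding AM_mtopology[OF \<sigma>] by force
qed

lemma Urysohn_pseudometric:
  assumes mZ: "metrizable_space Z" and A: "closedin Z A" "closedin Z B" "A \<inter> B = {}"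
  obtains f :: "'a \<Rightarrow> real" where "fun_pm Z f \<in> PM Z" "\<And>x. x \<in> A \<Longrightarrow> f x = 1" "\<And>x. x \<in> B \<Longrightarrow> f x = 0"
proof -
  have "disjnt B A" using A(3) by (auto simp: disjnt_def)
  then obtain f where f: "continuous_map Z (top_of_set {0..1::real}) f" "f ` B \<subseteq> {0}" "f ` A \<subseteq> {1}"
    using Urysohn_lemma[OF metrizable_imp_normal_space[OF mZ] A(2,1), of 0 1] by auto
  have "f x \<in> {0..1}" if "x \<in> topspace Z" for x
    using continuous_map_image_subset_topspace[OF f(1)] that by auto
  then have "fun_pm Z f \<in> PM Z"
    using f(1) by (intro fun_pm_in_PM[where B = 1]) (auto simp: continuous_map_in_subtopology)
  then show ?thesis using that f by blast
qed

text \<open>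
Pairs that escape from the space are detected by an oscillating pseudometric: if the points \<open>y n\<close>
had no limit point, one could thin out the sequence so that its terms of even index, on one side,
and its terms of odd index together with all partners, on the other side, have disjoint closures. A
function separating these closures yields a pseudometric which alternates between \<open>1\<close> and \<open>0\<close> along the
thinned sequence of pairs.
\<close>

lemma pseudometrically_convergent_pairs_have_limit_point:
  assumes mZ: "metrizable_space Z"
    and y: "\<And>n. y n \<in> topspace Z" "\<And>n. y' n \<in> topspace Z" "\<And>n. y n \<noteq> y' n"
    and conv: "\<And>q. q \<in> PM Z \<Longrightarrow> convergent (\<lambda>n. q (y n) (y' n))"
  obtains r l where "strict_mono (r :: nat \<Rightarrow> nat)" "limitin Z (y \<circ> r) l sequentially"
proof (rule ccontr)
  assume "\<not> thesis"
  then have no: "\<nexists>r l. strict_mono (r :: nat \<Rightarrow> nat) \<and> limitin Z (y \<circ> r) l sequentially"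
    using that by blast
  obtain \<sigma> where \<sigma>: "\<sigma> \<in> AM Z" using AM_nonempty[OF mZ] by blast
  interpret Metric_space "topspace Z" \<sigma> by (rule AM_Metric_space[OF \<sigma>])
  have y_away: "\<exists>\<epsilon>>0. \<forall>\<^sub>F n in sequentially. \<epsilon> \<le> \<sigma> l (y n)" if "l \<in> topspace Z" for l
  proof -
    have "\<nexists>r. strict_mono (r :: nat \<Rightarrow> nat) \<and> limitin Z (y \<circ> r) l sequentially"
      using no by blast
    from no_convergent_subsequence_away[OF \<sigma> y(1) that this] show ?thesis by blast
  qed
  \<comment> \<open>After passing to a subsequence, the partners stay away from almost all points of the first
    sequence: they either converge, or have no limit point at all.\<close>
  obtain r N0 where r: "strict_mono (r :: nat \<Rightarrow> nat)" and
    v_away: "\<And>n. n \<ge> N0 \<Longrightarrow> \<exists>\<epsilon>>0. \<forall>\<^sub>F m in sequentially. \<epsilon> \<le> \<sigma> (y (r n)) (y' (r m))"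
  proof (cases "\<exists>r l. strict_mono (r :: nat \<Rightarrow> nat) \<and> limitin Z (y' \<circ> r) l sequentially")
    case True
    then obtain r l where r: "strict_mono (r :: nat \<Rightarrow> nat)" and lim: "limitin Z (y' \<circ> r) l sequentially"
      by blast
    have l: "l \<in> topspace Z" using lim by (simp add: limitin_def)
    obtain \<epsilon> where \<epsilon>: "\<epsilon> > 0" "\<forall>\<^sub>F n in sequentially. \<epsilon> \<le> \<sigma> l (y n)" using y_away[OF l] by blast
    have "\<forall>\<^sub>F n in sequentially. \<epsilon> \<le> \<sigma> l (y (r n))"
      using eventually_subseq[OF r \<epsilon>(2)] .
    then obtain N0 where N0: "\<And>n. n \<ge> N0 \<Longrightarrow> \<epsilon> \<le> \<sigma> l (y (r n))"
      unfolding eventually_sequentially by blast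
    have "\<forall>\<^sub>F m in sequentially. (y' \<circ> r) m \<in> topspace Z \<and> \<sigma> ((y' \<circ> r) m) l < \<epsilon> / 2"
      using lim half_gt_zero[OF \<epsilon>(1)] limitin_metric[of "y' \<circ> r" l sequentially]
      unfolding AM_mtopology[OF \<sigma>] by blast
    then have "\<forall>\<^sub>F m in sequentially. \<epsilon> / 2 \<le> \<sigma> (y (r n)) (y' (r m))" if "n \<ge> N0" for n
    proof eventually_elim
      case (elim m)
      then show ?case
        using N0[OF that] triangle[OF l y(2)[of "r m"] y(1)[of "r n"]] commute[of l "y' (r m)"]
          commute[of "y (r n)" "y' (r m)"] unfolding o_def by linarith
    qed
    then show ?thesis using that[OF r, of N0] \<epsilon>(1) by (meson half_gt_zero)
  next
    case False
    have "\<exists>\<epsilon>>0. \<forall>\<^sub>F m in sequentially. \<epsilon> \<le> \<sigma> (y n) (y' m)" for n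
    proof -
      have "\<nexists>r. strict_mono (r :: nat \<Rightarrow> nat) \<and> limitin Z (y' \<circ> r) (y n) sequentially"
        using False by blast
      from no_convergent_subsequence_away[OF \<sigma> y(2) y(1) this] show ?thesis by blast
    qed
    then show ?thesis using that[OF strict_mono_id, of 0] by simp
  qed
  define u v where "u = y \<circ> r" and "v = y' \<circ> r"
  have uv: "u n \<in> topspace Z" "v n \<in> topspace Z" "u n \<noteq> v n" for n using y by (auto simp: u_def v_def)
  have u_away: "\<exists>\<epsilon>>0. \<forall>\<^sub>F n in sequentially. \<epsilon> \<le> \<sigma> l (u n)" if l: "l \<in> topspace Z" for l
  proof -
    obtain \<epsilon> where \<epsilon>: "\<epsilon> > 0" "\<forall>\<^sub>F n in sequentially. \<epsilon> \<le> \<sigma> l (y n)" using y_away[OF l] by blast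
    have "\<forall>\<^sub>F n in sequentially. \<epsilon> \<le> \<sigma> l (u n)"
      using eventually_subseq[OF r \<epsilon>(2)] by (simp add: u_def)
    then show ?thesis using \<epsilon>(1) by blast
  qed
  define P where "P n m \<longleftrightarrow> u m \<noteq> u n \<and> u m \<noteq> v n \<and> v m \<noteq> u n" for n m
  have ev_ne: "\<forall>\<^sub>F m in sequentially. w m \<noteq> l"
    if away: "\<exists>\<epsilon>>0. \<forall>\<^sub>F n in sequentially. \<epsilon> \<le> \<sigma> l (w n)" and l: "l \<in> topspace Z" for w l
  proof -
    obtain \<epsilon> where "\<epsilon> > 0" "\<forall>\<^sub>F n in sequentially. \<epsilon> \<le> \<sigma> l (w n)" using away by blast
    from this(2) show ?thesis
    proof eventually_elim
      case (elim n)
      have "\<sigma> l l < \<epsilon>" using \<open>\<epsilon> > 0\<close> mdist_zero[OF l] by linarith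
      then show ?case using elim by (metis linorder_not_le)
    qed
  qed
  have evP: "\<forall>\<^sub>F m in sequentially. P n m" if "n \<ge> N0" for n
  proof -
    have "\<exists>\<epsilon>>0. \<forall>\<^sub>F m in sequentially. \<epsilon> \<le> \<sigma> (u n) (v m)"
      using v_away[OF that] by (simp add: u_def v_def)
    note 1 = ev_ne[OF this uv(1)]
    note 2 = ev_ne[OF u_away[OF uv(1)] uv(1), of n] and 3 = ev_ne[OF u_away[OF uv(2)] uv(2), of n]
    show ?thesis
      unfolding P_def by (intro eventually_conj 1 2 3)
  qed
  \<comment> \<open>A sparse choice of indices makes the selected points of the first sequence different from each
    other and from all selected partners.\<close>
  have "\<exists>s. \<forall>k. s k \<ge> N0 \<and> (s k < s (Suc k) \<and> (\<forall>n\<in>{N0..s k}. \<forall>m\<ge>s (Suc k). P n m))"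
  proof (rule dependent_nat_choice)
    fix x k :: nat
    have "\<forall>\<^sub>F m in sequentially. \<forall>n\<in>{N0..x}. P n m"
      using evP by (intro eventually_ball_finite) auto
    then obtain M where M: "\<And>m n. m \<ge> M \<Longrightarrow> n \<in> {N0..x} \<Longrightarrow> P n m"
      unfolding eventually_sequentially by blast
    then show "\<exists>y\<ge>N0. x < y \<and> (\<forall>n\<in>{N0..x}. \<forall>m\<ge>y. P n m)"
      by (intro exI[of _ "max (max M N0) (Suc x)"]) auto
  qed auto
  then obtain s where s: "\<And>k. s k \<ge> N0" "\<And>k. s k < s (Suc k)"
    and sPn: "\<And>k n m. n \<in> {N0..s k} \<Longrightarrow> m \<ge> s (Suc k) \<Longrightarrow> P n m"
    by metis
  have sm: "strict_mono s" using s(2) by (simp add: strict_mono_Suc_iff)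
  have sP: "P (s i) (s j)" if "i < j" for i j
    using sPn[of "s i" i "s j"] s(1)[of i] strict_mono_leD[OF sm, of "Suc i" j] that by auto
  define A where "A = Z closure_of (u ` s ` {k. even k})"
  define B where "B = Z closure_of (u ` s ` {k. odd k}) \<union> Z closure_of (v ` range s)"
  have "A \<inter> B = {}"
  proof (rule ccontr)
    assume "A \<inter> B \<noteq> {}"
    then obtain x where x: "x \<in> A" "x \<in> B" by blast
    have xZ: "x \<in> topspace Z" using x(1) closure_of_subset_topspace unfolding A_def by fastforce
    obtain \<epsilon> where \<epsilon>: "\<epsilon> > 0" "\<forall>\<^sub>F n in sequentially. \<epsilon> \<le> \<sigma> x (u n)" using u_away[OF xZ] by blast
    obtain k where k: "even k" "x = u (s k)"
      using away_not_in_closure[OF \<sigma> uv(1) xZ \<epsilon>, of "s ` {k. even k}"] x(1)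
      unfolding A_def by blast
    have 1: "u n \<noteq> x" if n: "n \<in> s ` {k. odd k}" for n
    proof -
    obtain j where j: "n = s j" "odd j" using n by blast
    then have "j < k \<or> k < j" using k(1) by (metis linorder_neqE_nat)
    then show ?thesis using sP[of j k] sP[of k j] j k unfolding P_def by metis
  qed
    have 2: "v n \<noteq> x" if n: "n \<in> range s" for n
    proof -
    obtain j where j: "n = s j" using n by blast
    consider "j < k" | "k < j" | "j = k" by linarith
    then show ?thesis
      using sP[of j k] sP[of k j] j k uv(3)[of "s k"] unfolding P_def by cases metis+
  qed
    have "\<exists>\<epsilon>>0. \<forall>\<^sub>F n in sequentially. \<epsilon> \<le> \<sigma> x (v n)"
      using v_away[OF s(1)[of k]] unfolding k(2) by (simp add: u_def v_def)
    then obtain \<epsilon>' where \<epsilon>': "\<epsilon>' > 0" "\<forall>\<^sub>F n in sequentially. \<epsilon>' \<le> \<sigma> x (v n)" by blast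
    show False
      using x(2) away_not_in_closure[OF \<sigma> uv(1) xZ \<epsilon> 1]
        away_not_in_closure[OF \<sigma> uv(2) xZ \<epsilon>' 2] unfolding B_def by blast
  qed
  then obtain f where f: "fun_pm Z f \<in> PM Z" "\<And>x. x \<in> A \<Longrightarrow> f x = 1" "\<And>x. x \<in> B \<Longrightarrow> f x = (0::real)"
    using Urysohn_pseudometric[OF mZ, of A B] by (metis A_def B_def closedin_Un closedin_closure_of)
  have inA: "u (s k) \<in> A" if "even k" for k
    using that uv(1) unfolding A_def by (intro subsetD[OF closure_of_subset]) auto
  have inB: "v (s k) \<in> B" for k
    using uv(2) unfolding B_def by (intro UnI2 subsetD[OF closure_of_subset]) auto
  have inB': "u (s k) \<in> B" if "odd k" for k
    using that uv(1) unfolding B_def by (intro UnI1 subsetD[OF closure_of_subset]) auto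
  obtain L where L: "(\<lambda>n. fun_pm Z f (y n) (y' n)) \<longlonglongrightarrow> L"
    using conv[OF f(1)] by (auto simp: convergent_def)
  define g where "g k = fun_pm Z f (y (r (s k))) (y' (r (s k)))" for k
  have g: "g \<longlonglongrightarrow> L"
    using LIMSEQ_subseq_LIMSEQ[OF L strict_mono_o[OF r sm]] by (simp add: o_def g_def[abs_def])
  have g1: "g (2 * k) = 1" for k
    using f(2)[OF inA[of "2 * k"]] f(3)[OF inB[of "2 * k"]] uv(1,2)[of "s (2 * k)"]
    by (simp add: g_def fun_pm_def u_def v_def)
  have g0: "g (2 * k + 1) = 0" for k
    using f(3)[OF inB'[of "2 * k + 1"]] f(3)[OF inB[of "2 * k + 1"]] uv(1,2)[of "s (2 * k + 1)"]
    by (simp add: g_def fun_pm_def u_def v_def)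
  have "(\<lambda>k. g (2 * k)) \<longlonglongrightarrow> L" "(\<lambda>k. g (2 * k + 1)) \<longlonglongrightarrow> L"
    using LIMSEQ_subseq_LIMSEQ[OF g, of "\<lambda>k. 2 * k"] LIMSEQ_subseq_LIMSEQ[OF g, of "\<lambda>k. 2 * k + 1"]
    by (auto simp: o_def strict_mono_def)
  then have "L = 1" "L = 0"
    unfolding g1 g0 by (auto simp: LIMSEQ_const_iff)
  then show False by simp
qed

lemma PM_tendsto:
  assumes q: "q \<in> PM Z" and y: "limitin Z y l sequentially" "\<And>n. y n \<in> topspace Z"
    and y': "limitin Z y' l' sequentially" "\<And>n. y' n \<in> topspace Z"
  shows "(\<lambda>n. q (y n) (y' n)) \<longlonglongrightarrow> q l l'"
proof (rule tendstoI)
  fix \<epsilon> :: real assume \<epsilon>: "\<epsilon> > 0"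
  have near: "\<forall>\<^sub>F n in sequentially. q l (y n) < \<epsilon> / 2" if "limitin Z y l sequentially" for y l
  proof -
    have l: "l \<in> topspace Z" using that by (simp add: limitin_def)
    obtain U where U: "openin Z U" "l \<in> U" "\<And>x. x \<in> U \<Longrightarrow> q l x < \<epsilon> / 2"
      using PM_small_nhd[OF q l, of "\<epsilon> / 2"] \<epsilon> by (metis half_gt_zero)
    then have "\<forall>\<^sub>F n in sequentially. y n \<in> U" using that unfolding limitin_def by blast
    then show ?thesis by eventually_elim (use U in blast)
  qed
  have l: "l \<in> topspace Z" "l' \<in> topspace Z" using y y' by (auto simp: limitin_def)
  show "\<forall>\<^sub>F n in sequentially. dist (q (y n) (y' n)) (q l l') < \<epsilon>"
    using near[OF y(1)] near[OF y'(1)]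
  proof eventually_elim
    case (elim n)
    then show ?case using PM_quad[OF q y(2)[of n] y'(2)[of n] l] by (simp add: dist_real_def)
  qed
qed

section \<open>Exact correspondence of pairs\<close>

text \<open>
Choose pairs \<open>(y n, y' n)\<close> at which \<open>T p\<close> tends to its maximum, \<open>p\<close> peaking at \<open>(a, b)\<close>. Approximating
them back in \<open>X\<close> shows that every \<open>T e\<close> converges along the sequence, to \<open>e a b\<close>. As the \<open>T e\<close> exhaust
\<open>PM Y\<close>, the sequence has a limit pair in \<open>Y\<close>, and evaluation there corresponds exactly to
evaluation at \<open>(a, b)\<close>.
\<close>

lemma isometry_transports_pair:
  assumes mX: "metrizable_space X" and mY: "metrizable_space Y"
    and T: "pm_isometry X (PM X) Y (PM Y) T" and Y: "topspace Y \<noteq> {}"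
    and ab: "a \<in> topspace X" "b \<in> topspace X" "a \<noteq> b"
  obtains u v where "u \<in> topspace Y" "v \<in> topspace Y" "\<And>e. e \<in> PM X \<Longrightarrow> T e u v = e a b"
proof -
  have X: "topspace X \<noteq> {}" using ab by blast
  define S where "S = inv_into (PM X) T"
  note S = isometry_inverse[OF T subset_refl Y, folded S_def]
  obtain p where p: "p \<in> PM X" "p a b = 1"
      "\<And>x y. x \<in> topspace X \<Longrightarrow> y \<in> topspace X \<Longrightarrow> p x y \<le> 1"
    and peak: "\<And>e \<epsilon>. e \<in> PM X \<Longrightarrow> \<epsilon> > 0 \<Longrightarrow>
       \<exists>\<delta>>0. \<forall>x\<in>topspace X. \<forall>y\<in>topspace X. 1 - \<delta> < p x y \<longrightarrow> \<bar>e x y - e a b\<bar> < \<epsilon>"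
    using strongly_peaking_pseudometric[OF mX ab] by blast
  \<comment> \<open>An error below \<open>1\<close> at every index keeps all pairs off the diagonal.\<close>
  define c where "c n = 1 / real (n + 2)" for n
  have c: "c n > 0" "c n < 1" for n by (auto simp: c_def)
  have "(\<lambda>n. inverse (real (n + 2))) \<longlonglongrightarrow> 0"
    using LIMSEQ_ignore_initial_segment[OF LIMSEQ_inverse_real_of_nat, of 1] by (simp add: add.commute)
  then have c0: "c \<longlonglongrightarrow> 0" by (simp add: c_def[abs_def] inverse_eq_divide)
  have "\<exists>u v. u \<in> topspace Y \<and> v \<in> topspace Y \<and> \<bar>T p u v - 1\<bar> \<le> c n" for n
    using isometry_approximates_pair[OF mX mY T Y ab, of "{p}" "c n"] p(1,2) c(1) by (metis empty_subsetI finite.emptyI finite.insertI insert_subset singletonI)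
  then obtain y y' where y: "\<And>n. y n \<in> topspace Y" "\<And>n. y' n \<in> topspace Y"
    "\<And>n. \<bar>T p (y n) (y' n) - 1\<bar> \<le> c n"
    by metis
  have ne: "y n \<noteq> y' n" for n
  proof
    assume "y n = y' n"
    then have "T p (y n) (y' n) = 0" using PM_refl[OF isometry_in[OF T p(1)]] by simp
    then show False using y(3)[of n] c(2)[of n] by simp
  qed
  have lim: "(\<lambda>n. T e (y n) (y' n)) \<longlonglongrightarrow> e a b" if e: "e \<in> PM X" for e
  proof (rule tendstoI)
    fix \<epsilon> :: real assume \<epsilon>: "\<epsilon> > 0"
    then have \<epsilon>2: "\<epsilon> / 2 > 0" by simp
    obtain \<delta> where \<delta>: "\<delta> > 0" "\<And>x y. x \<in> topspace X \<Longrightarrow> y \<in> topspace X \<Longrightarrow> 1 - \<delta> < p x y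
        \<Longrightarrow> \<bar>e x y - e a b\<bar> < \<epsilon> / 2"
      using peak[OF e \<epsilon>2] by blast
    have "\<forall>\<^sub>F n in sequentially. c n < min (\<epsilon> / 2) (\<delta> / 2)"
      using order_tendstoD(2)[OF c0, of "min (\<epsilon> / 2) (\<delta> / 2)"] \<delta>(1) \<epsilon>2 by simp
    then show "\<forall>\<^sub>F n in sequentially. dist (T e (y n) (y' n)) (e a b) < \<epsilon>"
    proof eventually_elim
      case (elim n)
      have TP: "finite {T p, T e}" "{T p, T e} \<subseteq> PM Y" using isometry_in[OF T] p e by auto
      obtain x x' where xx: "x \<in> topspace X" "x' \<in> topspace X"
        "\<And>q. q \<in> {T p, T e} \<Longrightarrow> \<bar>S q x x' - q (y n) (y' n)\<bar> \<le> c n"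
        using isometry_approximates_pair[OF mY mX S(1) X y(1,2) ne TP c(1)] by blast
      have "\<bar>p x x' - T p (y n) (y' n)\<bar> \<le> c n" "\<bar>e x x' - T e (y n) (y' n)\<bar> \<le> c n"
        using xx(3)[of "T p"] xx(3)[of "T e"] S(2)[OF p(1)] S(2)[OF e] by auto
      moreover from this have "1 - \<delta> < p x x'" using y(3)[of n] elim by simp linarith
      then have "\<bar>e x x' - e a b\<bar> < \<epsilon> / 2" using \<delta>(2) xx by blast
      moreover have "c n < \<epsilon> / 2" using elim by simp
      ultimately show ?case unfolding dist_real_def by linarith
    qed
  qed
  have conv: "convergent (\<lambda>n. q (y n) (y' n))" if "q \<in> PM Y" for q
    using lim[OF S(4)[OF that]] S(3)[OF that] by (auto simp: convergent_def)
  obtain r l where r: "strict_mono (r :: nat \<Rightarrow> nat)" "limitin Y (y \<circ> r) l sequentially"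
    using pseudometrically_convergent_pairs_have_limit_point[of Y y y', OF mY y(1,2) ne conv] by blast
  have conv': "convergent (\<lambda>n. q ((y' \<circ> r) n) ((y \<circ> r) n))" if "q \<in> PM Y" for q
    using convergent_subseq_convergent[OF conv[OF that] r(1)] PM_commute[OF that] by (simp add: o_def)
  obtain r' l' where r': "strict_mono (r' :: nat \<Rightarrow> nat)" "limitin Y (y' \<circ> r \<circ> r') l' sequentially"
    using pseudometrically_convergent_pairs_have_limit_point[OF mY, of "y' \<circ> r" "y \<circ> r"] y(1,2) ne conv'
    by (metis comp_apply)
  have r2: "limitin Y (y \<circ> r \<circ> r') l sequentially"
    using limitin_subsequence[OF r'(1) r(2)] .
  have "T e l l' = e a b" if e: "e \<in> PM X" for e
  proof (rule LIMSEQ_unique)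
    show "(\<lambda>n. T e ((y \<circ> r \<circ> r') n) ((y' \<circ> r \<circ> r') n)) \<longlonglongrightarrow> T e l l'"
      using PM_tendsto[OF isometry_in[OF T e] r2 _ r'(2)] y by simp
    show "(\<lambda>n. T e ((y \<circ> r \<circ> r') n) ((y' \<circ> r \<circ> r') n)) \<longlonglongrightarrow> e a b"
      using LIMSEQ_subseq_LIMSEQ[OF lim[OF e] strict_mono_o[OF r(1) r'(1)]] by (simp add: o_def)
  qed
  then show ?thesis using that[of l l'] r(2) r'(2) by (auto simp: limitin_def)
qed

section \<open>From pairs of points to points\<close>

lemma finite_sets_separated:
  assumes mZ: "metrizable_space Z" and A: "finite A" "A \<subseteq> topspace Z" "w \<in> topspace Z" "w \<notin> A"
  obtains f :: "'a \<Rightarrow> real" where "fun_pm Z f \<in> PM Z" "f w = 1" "\<And>x. x \<in> A \<Longrightarrow> f x = 0"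
proof -
  have "closedin Z {w}" "closedin Z A"
    using metrizable_imp_t1_space[OF mZ] A unfolding t1_space_closedin_finite by auto
  then show ?thesis
    using Urysohn_pseudometric[OF mZ, of "{w}" A] A that by (metis Int_insert_left_if0 inf_bot_left insertI1)
qed

text \<open>
The assumption \<open>x \<noteq> y\<close> is essential: every pseudometric vanishes on the whole diagonal.
\<close>

lemma PM_separates_pairs:
  assumes mZ: "metrizable_space Z"
    and Z: "x \<in> topspace Z" "y \<in> topspace Z" "x' \<in> topspace Z" "y' \<in> topspace Z" and "x \<noteq> y"
    and eq: "\<And>q. q \<in> PM Z \<Longrightarrow> q x y = q x' y'"
  shows "{x, y} = {x', y'}"
proof -
  have sub: "w \<in> {x', y'}" if w: "(w = x \<and> w' = y) \<or> (w = y \<and> w' = x)" for w w'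
  proof (rule ccontr)
    assume "w \<notin> {x', y'}"
    then have "w \<notin> {w', x', y'}" using w \<open>x \<noteq> y\<close> by auto
    moreover have "finite {w', x', y'}" "{w', x', y'} \<subseteq> topspace Z" "w \<in> topspace Z"
      using w Z by auto
    ultimately obtain f :: "'a \<Rightarrow> real"
      where f: "fun_pm Z f \<in> PM Z" "f w = 1" "\<And>v. v \<in> {w', x', y'} \<Longrightarrow> f v = 0"
      using finite_sets_separated[OF mZ] by metis
    show False using eq[OF f(1)] w f(2,3) Z by (auto simp: fun_pm_def)
  qed
  show ?thesis using sub[of x y] sub[of y x] \<open>x \<noteq> y\<close> by auto
qed

text \<open>
The triangle inequality recognises triangles among triples of pairs: if some point belonged to only
one of the three pairs, the pseudometric of a function that is \<open>1\<close> at this point and \<open>0\<close> at the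
others would violate it.
\<close>

lemma pairs_form_triangle:
  assumes mZ: "metrizable_space Z"
    and Z: "{u1, v1, u2, v2, u3, v3} \<subseteq> topspace Z"
    and ne: "u1 \<noteq> v1" "u2 \<noteq> v2" "u3 \<noteq> v3" "{u1, v1} \<noteq> {u2, v2}" "{u1, v1} \<noteq> {u3, v3}" "{u2, v2} \<noteq> {u3, v3}"
    and tri: "\<And>q. q \<in> PM Z \<Longrightarrow> q u1 v1 \<le> q u2 v2 + q u3 v3"
      "\<And>q. q \<in> PM Z \<Longrightarrow> q u2 v2 \<le> q u1 v1 + q u3 v3"
      "\<And>q. q \<in> PM Z \<Longrightarrow> q u3 v3 \<le> q u1 v1 + q u2 v2"
  shows "\<exists>u v s. u \<noteq> v \<and> u \<noteq> s \<and> v \<noteq> s \<and> {u1, v1} = {u, v} \<and> {u2, v2} = {u, s} \<and> {u3, v3} = {v, s}"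
proof -
  have shared: "w = x \<or> w = y \<or> w = x' \<or> w = y'"
    if W: "{w, w', x, y, x', y'} \<subseteq> topspace Z" "w \<noteq> w'"
      and q: "\<And>q. q \<in> PM Z \<Longrightarrow> q w w' \<le> q x y + q x' y'" for w w' x y x' y'
  proof (rule ccontr)
    assume "\<not> (w = x \<or> w = y \<or> w = x' \<or> w = y')"
    then have "w \<notin> {w', x, y, x', y'}" using W by auto
    moreover have "finite {w', x, y, x', y'}" "{w', x, y, x', y'} \<subseteq> topspace Z" "w \<in> topspace Z"
      using W by auto
    ultimately obtain f :: "'a \<Rightarrow> real"
      where f: "fun_pm Z f \<in> PM Z" "f w = 1" "\<And>v. v \<in> {w', x, y, x', y'} \<Longrightarrow> f v = 0"
      using finite_sets_separated[OF mZ] by metis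
    show False using q[OF f(1)] f(2,3) W by (auto simp: fun_pm_def)
  qed
  have tri': "q v1 u1 \<le> q u2 v2 + q u3 v3" "q v2 u2 \<le> q u1 v1 + q u3 v3"
    "q v3 u3 \<le> q u1 v1 + q u2 v2" if "q \<in> PM Z" for q
    using tri[OF that] PM_commute[OF that] by metis+
  have in1: "u1 = u2 \<or> u1 = v2 \<or> u1 = u3 \<or> u1 = v3" "v1 = u2 \<or> v1 = v2 \<or> v1 = u3 \<or> v1 = v3"
    using shared[of u1 v1 u2 v2 u3 v3, OF _ ne(1) tri(1)]
      shared[of v1 u1 u2 v2 u3 v3, OF _ ne(1)[symmetric] tri'(1)] Z by simp_all
  have in2: "u2 = u1 \<or> u2 = v1 \<or> u2 = u3 \<or> u2 = v3" "v2 = u1 \<or> v2 = v1 \<or> v2 = u3 \<or> v2 = v3"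
    using shared[of u2 v2 u1 v1 u3 v3, OF _ ne(2) tri(2)]
      shared[of v2 u2 u1 v1 u3 v3, OF _ ne(2)[symmetric] tri'(2)] Z by simp_all
  have in3: "u3 = u1 \<or> u3 = v1 \<or> u3 = u2 \<or> u3 = v2" "v3 = u1 \<or> v3 = v1 \<or> v3 = u2 \<or> v3 = v2"
    using shared[of u3 v3 u1 v1 u2 v2, OF _ ne(3) tri(3)]
      shared[of v3 u3 u1 v1 u2 v2, OF _ ne(3)[symmetric] tri'(3)] Z by simp_all
  have key: "\<exists>s. s \<noteq> u \<and> s \<noteq> v \<and> {x, y} = {u, s} \<and> {x', y'} = {v, s}"
    if "u = x \<or> u = y" "u \<noteq> v" "x \<noteq> y" "x' \<noteq> y'" "{u, v} \<noteq> {x, y}"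
      "v = x \<or> v = y \<or> v = x' \<or> v = y'" "x = u \<or> x = v \<or> x = x' \<or> x = y'"
      "y = u \<or> y = v \<or> y = x' \<or> y = y'" for u v x y x' y' :: 'a
  proof -
    define s where "s = (if u = x then y else x)"
    have s: "s \<noteq> u" "{x, y} = {u, s}" using that(1,3) by (auto simp: s_def)
    then have "s \<noteq> v" using that(5) by blast
    moreover have "v \<notin> {x, y}" unfolding s(2) using calculation that(2) by blast
    then have "v = x' \<or> v = y'" using that(6) by blast
    moreover have "s = x \<or> s = y" by (simp add: s_def)
    then have "s = x' \<or> s = y'" using that(7,8) s(1) \<open>s \<noteq> v\<close> by metis
    ultimately have "{x', y'} = {v, s}" by blast
    then show ?thesis using s \<open>s \<noteq> v\<close> by blast
  qed
  show ?thesis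
  proof (cases "u1 = u2 \<or> u1 = v2")
    case True
    from key[OF True ne(1,2,3,4) in1(2) in2]
    obtain s where "s \<noteq> u1" "s \<noteq> v1" "{u2, v2} = {u1, s}" "{u3, v3} = {v1, s}" by blast
    then have "u1 \<noteq> v1 \<and> u1 \<noteq> s \<and> v1 \<noteq> s \<and> {u1, v1} = {u1, v1} \<and> {u2, v2} = {u1, s} \<and> {u3, v3} = {v1, s}"
      using ne(1) by simp
    then show ?thesis by (intro exI)
  next
    case False
    then have "u1 = u3 \<or> u1 = v3" using in1(1) by blast
    from key[OF this ne(1,3,2,5) _ in3] in1(2)
    obtain s where "s \<noteq> u1" "s \<noteq> v1" "{u3, v3} = {u1, s}" "{u2, v2} = {v1, s}" by blast
    then have "v1 \<noteq> u1 \<and> v1 \<noteq> s \<and> u1 \<noteq> s \<and> {u1, v1} = {v1, u1} \<and> {u2, v2} = {v1, s} \<and> {u3, v3} = {u1, s}"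
      using ne(1) insert_commute[of u1 v1 "{}"] by simp
    then show ?thesis by (intro exI)
  qed
qed

text \<open>
For a fixed vertex \<open>a\<close> the edges \<open>E a d\<close> all pass through one point, which becomes the image of \<open>a\<close>. Two of
them share a point \<open>u\<close>; a third one missing \<open>u\<close> would have to be the remaining side of the triangle
spanned by those two, which is already the image of the side opposite to \<open>a\<close>, contrary to
injectivity.
\<close>

lemma triangle_preserving_edge_map_is_induced:
  assumes tri: "\<And>a b c. a \<in> A \<Longrightarrow> b \<in> A \<Longrightarrow> c \<in> A \<Longrightarrow> a \<noteq> b \<Longrightarrow> a \<noteq> c \<Longrightarrow> b \<noteq> c \<Longrightarrow>
      \<exists>u v s. u \<noteq> v \<and> u \<noteq> s \<and> v \<noteq> s \<and> E a b = {u, v} \<and> E a c = {u, s} \<and> E b c = {v, s}"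
    and inj: "\<And>a b c d. a \<in> A \<Longrightarrow> b \<in> A \<Longrightarrow> c \<in> A \<Longrightarrow> d \<in> A \<Longrightarrow> a \<noteq> b \<Longrightarrow> c \<noteq> d \<Longrightarrow>
      E a b = E c d \<Longrightarrow> {a, b} = {c, d}"
    and sym: "\<And>a b. E a b = E b a"
    and third: "\<And>a b. a \<in> A \<Longrightarrow> b \<in> A \<Longrightarrow> \<exists>c\<in>A. c \<noteq> a \<and> c \<noteq> b"
  obtains \<psi> where "\<And>a b. a \<in> A \<Longrightarrow> b \<in> A \<Longrightarrow> a \<noteq> b \<Longrightarrow> E a b = {\<psi> a, \<psi> b} \<and> \<psi> a \<noteq> \<psi> b"
proof -
  have "\<exists>u. \<forall>d\<in>A. d \<noteq> a \<longrightarrow> u \<in> E a d" if a: "a \<in> A" for a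
  proof -
    obtain b where b: "b \<in> A" "b \<noteq> a" using third[OF a a] by blast
    obtain c where c: "c \<in> A" "c \<noteq> a" "c \<noteq> b" using third[OF a b(1)] by blast
    obtain u v s where uvs: "u \<noteq> v" "u \<noteq> s" "v \<noteq> s" "E a b = {u, v}" "E a c = {u, s}" "E b c = {v, s}"
      using tri[OF a b(1) c(1) b(2)[symmetric] c(2,3)[symmetric]] by blast
    have "u \<in> E a d" if d: "d \<in> A" "d \<noteq> a" for d
    proof (rule ccontr)
      assume u: "u \<notin> E a d"
      then have db: "d \<noteq> b" "d \<noteq> c" using uvs by auto
      obtain u1 s1 where 1: "u1 \<in> E a b" "E a d = {u1, s1}" "u1 \<noteq> s1"
        using tri[OF a b(1) d(1) b(2)[symmetric] d(2)[symmetric] db(1)[symmetric]] by blast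
      obtain u2 where 2: "u2 \<in> E a c" "u2 \<in> E a d"
        using tri[OF a c(1) d(1) c(2)[symmetric] d(2)[symmetric] db(2)[symmetric]] by blast
      have "v \<in> E a d" using u uvs(4) 1(1,2) by auto
      moreover have "s \<in> E a d" using u uvs(5) 2 by auto
      ultimately have "E a d = {v, s}" using 1(2) uvs(3) by auto
      then have "E a d = E b c" using uvs(6) by simp
      then have "{a, d} = {b, c}" using inj[OF a d(1) b(1) c(1) d(2)[symmetric] c(3)[symmetric]] by blast
      then show False using b c by auto
    qed
    then show ?thesis by blast
  qed
  then obtain \<psi> where \<psi>: "\<And>a d. a \<in> A \<Longrightarrow> d \<in> A \<Longrightarrow> d \<noteq> a \<Longrightarrow> \<psi> a \<in> E a d" by metis
  have "E a b = {\<psi> a, \<psi> b} \<and> \<psi> a \<noteq> \<psi> b" if ab: "a \<in> A" "b \<in> A" "a \<noteq> b" for a b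
  proof -
    obtain c where c: "c \<in> A" "c \<noteq> a" "c \<noteq> b" using third[OF ab(1,2)] by blast
    obtain u v s where "u \<noteq> v" "u \<noteq> s" "v \<noteq> s" "E a b = {u, v}" "E a c = {u, s}" "E b c = {v, s}"
      using tri[OF ab(1,2) c(1) ab(3) c(2,3)[symmetric]] by blast
    moreover have "\<psi> a \<in> E a b" "\<psi> a \<in> E a c" "\<psi> b \<in> E a b" "\<psi> b \<in> E b c"
      using \<psi>[OF ab(1,2)] \<psi>[OF ab(1) c(1)] \<psi>[OF ab(2,1)] \<psi>[OF ab(2) c(1)] ab(3) c(2,3) sym[of b a]
      by auto
    ultimately show ?thesis by auto
  qed
  then show ?thesis using that by blast
qed

lemma PM_nonzero_at_pair:
  assumes mZ: "metrizable_space Z" and "x \<in> topspace Z" "y \<in> topspace Z" "x \<noteq> y"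
  obtains q where "q \<in> PM Z" "q x y \<noteq> 0"
  using AM_nonempty[OF mZ] AM_pos[of _ Z x y] AM_PM assms by (metis less_irrefl)

text \<open>
Each edge of the complete graph on \<open>X\<close> corresponds to exactly one edge on \<open>Y\<close>, and triangle inequalities
between pseudometrics are preserved, so triangles go to triangles. Spaces with one or two points
have no triangles and are treated separately.
\<close>

lemma isometry_induced_by_bijection:
  assumes mX: "metrizable_space X" and mY: "metrizable_space Y"
    and X: "topspace X \<noteq> {}" and Y: "topspace Y \<noteq> {}"
    and T: "pm_isometry X (PM X) Y (PM Y) T"
  obtains \<psi> where "bij_betw \<psi> (topspace X) (topspace Y)"
    "\<And>e a b. e \<in> PM X \<Longrightarrow> a \<in> topspace X \<Longrightarrow> b \<in> topspace X \<Longrightarrow> T e (\<psi> a) (\<psi> b) = e a b"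
proof -
  define S where "S = inv_into (PM X) T"
  note S = isometry_inverse[OF T subset_refl Y, folded S_def]
  \<comment> \<open>The pair \<open>{a, b}\<close> of \<open>X\<close> corresponds to the pair \<open>{u, v}\<close> of \<open>Y\<close>.\<close>
  define R where "R a b u v \<longleftrightarrow> u \<in> topspace Y \<and> v \<in> topspace Y \<and> (\<forall>e\<in>PM X. T e u v = e a b)" for a b u v
  have R_sym: "R a b v u" "R b a u v" if "R a b u v" for a b u v
  proof -
    have "T e v u = T e u v" "e b a = e a b" if "e \<in> PM X" for e
      using PM_commute[OF isometry_in[OF T that]] PM_commute[OF that] by auto
    then show "R a b v u" "R b a u v" using that unfolding R_def by metis+
  qed
  have R_ex: "\<exists>u v. R a b u v" if "a \<in> topspace X" "b \<in> topspace X" "a \<noteq> b" for a b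
    using isometry_transports_pair[OF mX mY T Y that] unfolding R_def by metis
  have R_ne: "u \<noteq> v" if "R a b u v" "a \<in> topspace X" "b \<in> topspace X" "a \<noteq> b" for a b u v
  proof
    assume "u = v"
    then have "e a b = 0" if "e \<in> PM X" for e
      using \<open>R a b u v\<close> PM_refl[OF isometry_in[OF T that], of v] that unfolding R_def by simp
    then show False using PM_nonzero_at_pair[OF mX that(2-4)] by blast
  qed
  have R_back: "\<exists>a b. a \<in> topspace X \<and> b \<in> topspace X \<and> a \<noteq> b \<and> R a b u v"
    if uv: "u \<in> topspace Y" "v \<in> topspace Y" "u \<noteq> v" for u v
  proof -
    obtain a b where ab: "a \<in> topspace X" "b \<in> topspace X" "\<And>q. q \<in> PM Y \<Longrightarrow> S q a b = q u v"
      using isometry_transports_pair[OF mY mX S(1) X uv] by metis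
    have "R a b u v" unfolding R_def using uv ab(3) isometry_in[OF T] S(2) by metis
    moreover have "a \<noteq> b"
    proof
      assume "a = b"
      then have "q u v = 0" if "q \<in> PM Y" for q using ab(3)[OF that] PM_refl[OF S(4)[OF that]] by simp
      then show False using PM_nonzero_at_pair[OF mY uv] by metis
    qed
    ultimately show ?thesis using ab by blast
  qed
  have R_fun: "{u, v} = {u', v'}"
    if R: "R a b u v" "R a b u' v'" and ab: "a \<in> topspace X" "b \<in> topspace X" "a \<noteq> b" for a b u v u' v'
  proof (rule PM_separates_pairs[OF mY])
    show "u \<noteq> v" using R_ne[OF R(1) ab] .
    show "q u v = q u' v'" if "q \<in> PM Y" for q
      using R S(3,4)[OF that] unfolding R_def by metis
  qed (use R in \<open>auto simp: R_def\<close>)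
  have R_inj: "{a, b} = {c, d}"
    if R: "R a b u v" "R c d u v" and ab: "a \<in> topspace X" "b \<in> topspace X" "a \<noteq> b"
      "c \<in> topspace X" "d \<in> topspace X" for a b c d u v
    using PM_separates_pairs[OF mX ab(1,2,4,5,3)] R unfolding R_def by metis
  define E where "E a b = {u. \<exists>v. R a b u v}" for a b
  have E_eq: "E a b = {u, v}"
    if R: "R a b u v" and ab: "a \<in> topspace X" "b \<in> topspace X" "a \<noteq> b" for a b u v
  proof (intro equalityI subsetI)
    show "x \<in> {u, v}" if x: "x \<in> E a b" for x
    proof -
      obtain w where "R a b x w" using x unfolding E_def by blast
      from R_fun[OF R this ab] show ?thesis by blast
    qed
    show "x \<in> E a b" if "x \<in> {u, v}" for x
      using that R R_sym(1)[OF R] unfolding E_def by blast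
  qed
  have E_R: "R a b u v"
    if E: "E a b = {u, v}" and ab: "a \<in> topspace X" "b \<in> topspace X" "a \<noteq> b" for a b u v
  proof -
    obtain u' v' where R: "R a b u' v'" using R_ex[OF ab] by blast
    have "{u', v'} = {u, v}" using E_eq[OF R ab] E by simp
    then have "u' = u \<and> v' = v \<or> u' = v \<and> v' = u" by (simp only: doubleton_eq_iff)
    then show ?thesis using R R_sym(1)[OF R] by blast
  qed
  have E_sym: "E a b = E b a" for a b unfolding E_def using R_sym(2) by blast
  have E_inj: "{a, b} = {c, d}"
    if ab: "a \<in> topspace X" "b \<in> topspace X" "c \<in> topspace X" "d \<in> topspace X" "a \<noteq> b" "c \<noteq> d" "E a b = E c d"
    for a b c d
  proof -
    obtain u v where R: "R a b u v" using R_ex[OF ab(1,2,5)] by blast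
    have "R c d u v" using E_R[OF _ ab(3,4,6)] E_eq[OF R ab(1,2,5)] ab(7) by simp
    from R_inj[OF R this ab(1,2,5,3,4)] show ?thesis .
  qed
  have E_tri: "\<exists>u v s. u \<noteq> v \<and> u \<noteq> s \<and> v \<noteq> s \<and> E a b = {u, v} \<and> E a c = {u, s} \<and> E b c = {v, s}"
    if abc: "a \<in> topspace X" "b \<in> topspace X" "c \<in> topspace X" "a \<noteq> b" "a \<noteq> c" "b \<noteq> c" for a b c
  proof -
    obtain u1 v1 u2 v2 u3 v3 where R: "R a b u1 v1" "R a c u2 v2" "R b c u3 v3"
      using R_ex[OF abc(1,2,4)] R_ex[OF abc(1,3,5)] R_ex[OF abc(2,3,6)] by blast
    note Es = E_eq[OF R(1) abc(1,2,4)] E_eq[OF R(2) abc(1,3,5)] E_eq[OF R(3) abc(2,3,6)]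
    have q: "q u1 v1 = S q a b" "q u2 v2 = S q a c" "q u3 v3 = S q b c" if "q \<in> PM Y" for q
      using R S(3)[OF that] S(4)[OF that] unfolding R_def by metis+
    have tri: "e a b \<le> e a c + e b c" "e a c \<le> e a b + e b c" "e b c \<le> e a b + e a c" if "e \<in> PM X" for e
      using PM_triangle[OF that abc(1,3,2)] PM_triangle[OF that abc(1,2,3)] PM_triangle[OF that abc(2,1,3)]
        PM_commute[OF that, of c b] PM_commute[OF that, of b a] by auto
    show ?thesis unfolding Es
    proof (rule pairs_form_triangle[OF mY])
      show "{u1, v1, u2, v2, u3, v3} \<subseteq> topspace Y" using R unfolding R_def by auto
      show "u1 \<noteq> v1" "u2 \<noteq> v2" "u3 \<noteq> v3"
        using R_ne[OF R(1) abc(1,2,4)] R_ne[OF R(2) abc(1,3,5)] R_ne[OF R(3) abc(2,3,6)] by simp_all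
      show "{u1, v1} \<noteq> {u2, v2}" "{u1, v1} \<noteq> {u3, v3}" "{u2, v2} \<noteq> {u3, v3}"
        using E_inj[OF abc(1,2,1,3,4,5)] E_inj[OF abc(1,2,2,3,4,6)] E_inj[OF abc(1,3,2,3,5,6)] abc(4-6)
        unfolding Es by (auto simp: doubleton_eq_iff)
      show "q u1 v1 \<le> q u2 v2 + q u3 v3" "q u2 v2 \<le> q u1 v1 + q u3 v3"
        "q u3 v3 \<le> q u1 v1 + q u2 v2" if "q \<in> PM Y" for q
        unfolding q[OF that] using tri[OF S(4)[OF that]] by auto
    qed
  qed
  show ?thesis
  proof (cases "\<exists>a b. a \<in> topspace X \<and> b \<in> topspace X \<and> a \<noteq> b")
    case False
    obtain a y where a: "a \<in> topspace X" and y: "y \<in> topspace Y" using X Y by blast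
    have "topspace X = {a}" using False a by blast
    moreover have "topspace Y = {y}" using R_back y False by blast
    moreover have "T e y y = e a a" if "e \<in> PM X" for e
      using PM_refl[OF that] PM_refl[OF isometry_in[OF T that]] by simp
    ultimately show ?thesis using that[of "\<lambda>_. y"] by (auto simp: bij_betw_def)
  next
    case True
    then obtain a0 b0 where ab0: "a0 \<in> topspace X" "b0 \<in> topspace X" "a0 \<noteq> b0" by blast
    obtain \<psi> where \<psi>: "\<And>a b. a \<in> topspace X \<Longrightarrow> b \<in> topspace X \<Longrightarrow> a \<noteq> b \<Longrightarrow> R a b (\<psi> a) (\<psi> b)"
    proof (cases "\<exists>c\<in>topspace X. c \<noteq> a0 \<and> c \<noteq> b0")
      case False
      obtain u v where R: "R a0 b0 u v" using R_ex ab0 by blast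
      define \<psi> where "\<psi> x = (if x = a0 then u else v)" for x
      have "R a b (\<psi> a) (\<psi> b)" if "a \<in> topspace X" "b \<in> topspace X" "a \<noteq> b" for a b
      proof -
        have "a = a0 \<and> b = b0 \<or> a = b0 \<and> b = a0" using that False by metis
        then show ?thesis using R R_sym(1)[OF R_sym(2)[OF R]] ab0 by (auto simp: \<psi>_def)
      qed
      then show ?thesis using that by blast
    next
      case True
      then have third: "\<exists>c\<in>topspace X. c \<noteq> a \<and> c \<noteq> b" if "a \<in> topspace X" "b \<in> topspace X" for a b
        using ab0 by metis
      obtain \<psi> where \<psi>: "\<And>a b. a \<in> topspace X \<Longrightarrow> b \<in> topspace X \<Longrightarrow> a \<noteq> b \<Longrightarrow>
          E a b = {\<psi> a, \<psi> b} \<and> \<psi> a \<noteq> \<psi> b"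
        using triangle_preserving_edge_map_is_induced[of "topspace X" E, OF E_tri E_inj E_sym third] by blast
      show ?thesis
      proof (rule that)
        show "R a b (\<psi> a) (\<psi> b)" if "a \<in> topspace X" "b \<in> topspace X" "a \<noteq> b" for a b
          using E_R[OF _ that] \<psi>[OF that] by blast
      qed
    qed
    have \<psi>_in: "\<psi> a \<in> topspace Y" if a: "a \<in> topspace X" for a
    proof -
      obtain b where "b \<in> topspace X" "b \<noteq> a" using ab0 by metis
      then show ?thesis using \<psi>[OF a, of b] unfolding R_def by auto
    qed
    have inj: "inj_on \<psi> (topspace X)"
    proof (rule inj_onI, rule ccontr)
      fix a b assume "a \<in> topspace X" "b \<in> topspace X" "\<psi> a = \<psi> b" "a \<noteq> b"
      then show False using R_ne[OF \<psi>] by blast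
    qed
    have surj: "y \<in> \<psi> ` topspace X" if y: "y \<in> topspace Y" for y
    proof -
      obtain y' where y': "y' \<in> topspace Y" "y \<noteq> y'"
        using \<psi>_in[OF ab0(1)] \<psi>_in[OF ab0(2)] R_ne[OF \<psi>[OF ab0] ab0] by (cases "y = \<psi> a0") blast+
      obtain c d where cd: "c \<in> topspace X" "d \<in> topspace X" "c \<noteq> d" "R c d y y'"
        using R_back[OF y y'] by blast
      then show ?thesis using R_fun[OF cd(4) \<psi>[OF cd(1-3)] cd(1-3)] by blast
    qed
    have "T e (\<psi> a) (\<psi> b) = e a b" if "e \<in> PM X" "a \<in> topspace X" "b \<in> topspace X" for e a b
    proof (cases "a = b")
      case True
      then show ?thesis using PM_refl[OF that(1)] PM_refl[OF isometry_in[OF T that(1)]] by simp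
    next
      case False
      then show ?thesis using \<psi>[OF that(2,3)] that(1) unfolding R_def by blast
    qed
    then show ?thesis using that[of \<psi>] inj surj \<psi>_in unfolding bij_betw_def by blast
  qed
qed

section \<open>The induced homeomorphism\<close>

text \<open>
Continuity of the point map comes for free: an admissible metric of the target, read through the
isometry, is one of the continuous pseudometrics of the source.
\<close>

lemma continuous_map_if_pulled_back_metric_in_PM:
  assumes \<sigma>: "\<sigma> \<in> AM Y" and e: "e \<in> PM X"
    and f: "\<And>a. a \<in> topspace X \<Longrightarrow> f a \<in> topspace Y"
    and eq: "\<And>a b. a \<in> topspace X \<Longrightarrow> b \<in> topspace X \<Longrightarrow> e a b = \<sigma> (f a) (f b)"
  shows "continuous_map X Y f"
proof -
  interpret Metric_space "topspace Y" \<sigma> by (rule AM_Metric_space[OF \<sigma>])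
  have "continuous_map X mtopology f"
    unfolding continuous_map_to_metric
  proof (intro ballI allI impI)
    fix x and \<epsilon> :: real assume x: "x \<in> topspace X" and \<epsilon>: "\<epsilon> > 0"
    obtain U where U: "openin X U" "x \<in> U" "\<And>y. y \<in> U \<Longrightarrow> e x y < \<epsilon>"
      using PM_small_nhd[OF e x \<epsilon>] by blast
    have "f y \<in> mball (f x) \<epsilon>" if "y \<in> U" for y
      using U(3)[OF that] eq[OF x, of y] f[OF x] f[of y] that openin_subset[OF U(1)] by auto
    then show "\<exists>U. openin X U \<and> x \<in> U \<and> (\<forall>y\<in>U. f y \<in> mball (f x) \<epsilon>)" using U by blast
  qed
  then show ?thesis using AM_mtopology[OF \<sigma>] by simp
qed

theorem PM_isometry_induced_by_homeomorphism:
  assumes mX: "metrizable_space X" and mY: "metrizable_space Y"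
    and X: "topspace X \<noteq> {}" and Y: "topspace Y \<noteq> {}"
    and T: "pm_isometry X (PM X) Y (PM Y) T"
  shows "\<exists>\<phi>. homeomorphic_map Y X \<phi> \<and>
    (\<forall>d\<in>PM X. \<forall>x\<in>topspace Y. \<forall>y\<in>topspace Y. T d x y = d (\<phi> x) (\<phi> y))"
proof -
  obtain \<psi> where bij: "bij_betw \<psi> (topspace X) (topspace Y)" and
    \<psi>: "\<And>e a b. e \<in> PM X \<Longrightarrow> a \<in> topspace X \<Longrightarrow> b \<in> topspace X \<Longrightarrow> T e (\<psi> a) (\<psi> b) = e a b"
    using isometry_induced_by_bijection[OF mX mY X Y T] by blast
  define \<phi> where "\<phi> = inv_into (topspace X) \<psi>"
  have \<phi>_in: "\<phi> y \<in> topspace X" and \<psi>\<phi>: "\<psi> (\<phi> y) = y" if "y \<in> topspace Y" for y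
    using bij that unfolding \<phi>_def bij_betw_def by (auto intro: inv_into_into f_inv_into_f)
  have \<psi>_in: "\<psi> a \<in> topspace Y" and \<phi>\<psi>: "\<phi> (\<psi> a) = a" if "a \<in> topspace X" for a
    using bij that unfolding \<phi>_def bij_betw_def by auto
  have \<phi>: "T d x y = d (\<phi> x) (\<phi> y)" if "d \<in> PM X" "x \<in> topspace Y" "y \<in> topspace Y" for d x y
    using \<psi>[OF that(1) \<phi>_in[OF that(2)] \<phi>_in[OF that(3)]] \<psi>\<phi> that by simp
  obtain \<sigma> where \<sigma>: "\<sigma> \<in> AM X" using AM_nonempty[OF mX] by blast
  obtain \<rho> where \<rho>: "\<rho> \<in> AM Y" using AM_nonempty[OF mY] by blast
  have "\<rho> \<in> T ` PM X" using T AM_PM[OF \<rho>] unfolding pm_isometry_def by simp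
  then obtain e where e: "e \<in> PM X" "\<rho> = T e" by blast
  have "continuous_map X Y \<psi>"
    using continuous_map_if_pulled_back_metric_in_PM[OF \<rho> e(1) \<psi>_in] \<psi>[OF e(1)] e(2) by simp
  moreover have "continuous_map Y X \<phi>"
    using continuous_map_if_pulled_back_metric_in_PM[OF \<sigma> isometry_in[OF T AM_PM[OF \<sigma>]] \<phi>_in]
      \<phi>[OF AM_PM[OF \<sigma>]] by simp
  ultimately have "homeomorphic_maps Y X \<phi> \<psi>"
    unfolding homeomorphic_maps_def using \<psi>\<phi> \<phi>\<psi> by simp
  then have "homeomorphic_map Y X \<phi>" using homeomorphic_map_maps by blast
  then show ?thesis using \<phi> by blast
qed

lemma third_point_if_card_ne_two:
  assumes "x \<in> A" "y \<in> A" "x \<noteq> y" "card A \<noteq> 2"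
  obtains z where "z \<in> A" "z \<noteq> x" "z \<noteq> y"
proof -
  have "A \<noteq> {x, y}" using assms by auto
  then show ?thesis using that assms by blast
qed

text \<open>
Two inducing maps agree on every pair of points up to a swap. If they swapped \<open>x\<close> with one point
they would swap it with every other point, and with at least two others this contradicts
injectivity.
\<close>

lemma inducing_map_unique:
  assumes mX: "metrizable_space X" and card: "card (topspace Y) \<noteq> 2"
    and \<phi>: "homeomorphic_map Y X \<phi>" and \<psi>: "homeomorphic_map Y X \<psi>"
    and eq: "\<And>d x y. d \<in> PM X \<Longrightarrow> x \<in> topspace Y \<Longrightarrow> y \<in> topspace Y \<Longrightarrow>
               d (\<phi> x) (\<phi> y) = d (\<psi> x) (\<psi> y)"
    and x: "x \<in> topspace Y"
  shows "\<psi> x = \<phi> x"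
proof (rule ccontr)
  assume ne: "\<psi> x \<noteq> \<phi> x"
  have \<phi>_inj: "inj_on \<phi> (topspace Y)" and \<phi>_im: "\<phi> ` topspace Y = topspace X"
    using homeomorphic_imp_injective_map[OF \<phi>] homeomorphic_imp_surjective_map[OF \<phi>] by auto
  have \<psi>_im: "\<psi> ` topspace Y = topspace X"
    using homeomorphic_imp_surjective_map[OF \<psi>] .
  have swap: "\<psi> x = \<phi> y" if y: "y \<in> topspace Y" "y \<noteq> x" for y
  proof -
    have "{\<phi> x, \<phi> y} = {\<psi> x, \<psi> y}"
    proof (rule PM_separates_pairs[OF mX])
      show "\<phi> x \<noteq> \<phi> y" using \<phi>_inj x y by (auto dest: inj_onD)
    qed (use \<phi>_im \<psi>_im x y eq in auto)
    then show ?thesis using ne by (auto simp: doubleton_eq_iff)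
  qed
  obtain y where y: "y \<in> topspace Y" "y \<noteq> x"
    using ne \<phi>_im \<psi>_im x by (metis imageE imageI)
  obtain z where z: "z \<in> topspace Y" "z \<noteq> x" "z \<noteq> y"
    using third_point_if_card_ne_two[OF x y(1) y(2)[symmetric] card] by blast
  show False using swap[OF y] swap[OF z(1,2)] \<phi>_inj y z by (metis inj_onD)
qed

section \<open>Uniquely peaking metrics are dense\<close>

lemma Pp_I:
  assumes d: "d \<in> AM Z" and zw: "z \<in> topspace Z" "w \<in> topspace Z"
    and less: "\<And>x y. x \<in> topspace Z \<Longrightarrow> y \<in> topspace Z \<Longrightarrow> {x, y} \<noteq> {z, w} \<Longrightarrow> d x y < d z w"
  shows "d \<in> Pp Z"
proof -
  have le: "d x y \<le> d z w" if "x \<in> topspace Z" "y \<in> topspace Z" for x y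
  proof (cases "{x, y} = {z, w}")
    case True
    then show ?thesis using PM_commute[OF AM_PM[OF d], of z w] by (auto simp: doubleton_eq_iff)
  qed (use less[OF that] in simp)
  have "pm_norm Z d \<le> d z w" using zw(1) le by (intro pm_norm_least) auto
  then have norm: "pm_norm Z d = d z w"
    using pm_norm_upper[OF AM_PM[OF d] zw] by simp
  have "\<exists>!S. \<exists>x\<in>topspace Z. \<exists>y\<in>topspace Z. S = {x, y} \<and> d x y = pm_norm Z d"
    unfolding norm using zw less by (intro ex1I[of _ "{z, w}"]) fastforce+
  then show ?thesis unfolding Pp_def using d by blast
qed

lemma Pp_E:
  assumes "d \<in> Pp Z"
  obtains z w where "d \<in> AM Z" "z \<in> topspace Z" "w \<in> topspace Z"
    "\<And>x y. x \<in> topspace Z \<Longrightarrow> y \<in> topspace Z \<Longrightarrow> {x, y} \<noteq> {z, w} \<Longrightarrow> d x y < d z w"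
proof -
  have d: "d \<in> AM Z"
    and ex: "\<exists>!S. \<exists>x\<in>topspace Z. \<exists>y\<in>topspace Z. S = {x, y} \<and> d x y = pm_norm Z d"
    using assms unfolding Pp_def by auto
  from ex obtain z w where zw: "z \<in> topspace Z" "w \<in> topspace Z" "d z w = pm_norm Z d" by blast
  have "d x y < d z w" if xy: "x \<in> topspace Z" "y \<in> topspace Z" "{x, y} \<noteq> {z, w}" for x y
  proof -
    have "d x y \<noteq> pm_norm Z d" using ex xy zw by blast
    then show ?thesis using pm_norm_upper[OF AM_PM[OF d] xy(1,2)] zw(3) by simp
  qed
  then show ?thesis using that[OF d zw(1,2)] by blast
qed

lemma Pp_subset_Pc: "Pp Z \<subseteq> Pc Z"
proof
  fix d assume "d \<in> Pp Z"
  then obtain z w where d: "d \<in> AM Z" and zw: "z \<in> topspace Z" "w \<in> topspace Z"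
    and less: "\<And>x y. x \<in> topspace Z \<Longrightarrow> y \<in> topspace Z \<Longrightarrow> {x, y} \<noteq> {z, w} \<Longrightarrow> d x y < d z w"
    using Pp_E by metis
  have "d z w \<le> pm_norm Z d" using pm_norm_upper[OF AM_PM[OF d] zw] .
  then have "x \<in> {z, w} \<and> y \<in> {z, w}"
    if "x \<in> topspace Z" "y \<in> topspace Z" "d x y = pm_norm Z d" for x y
    using less[OF that(1,2)] that(3) by fastforce
  moreover have "compactin Z {z, w}" using zw by (simp add: finite_imp_compactin)
  ultimately show "d \<in> Pc Z" unfolding Pc_def using d by blast
qed

lemma Pc_subset_AM: "Pc Z \<subseteq> AM Z"
  unfolding Pc_def by blast

text \<open>
First add a small multiple of an admissible metric, to obtain an admissible \<open>\<tau>\<close>. Then choose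
\<open>(a, b)\<close> where \<open>\<tau>\<close> comes within \<open>s\<close> of its supremum and add the oscillation of the bumps of height \<open>s\<close>.
Away from the bumps the sum gains at most \<open>s\<close>, which is not enough to catch up with the gain \<open>2 s\<close> at
\<open>(a, b)\<close>; inside the bumps the slope \<open>2\<close> outweighs the growth of \<open>\<tau>\<close>.
\<close>

lemma Pp_dense:
  assumes mZ: "metrizable_space Z" and Z: "topspace Z \<noteq> {}" and d: "d \<in> PM Z" and \<epsilon>: "\<epsilon> > 0"
  obtains m where "m \<in> Pp Z" "pm_dist Z m d < \<epsilon>"
proof -
  obtain \<sigma> where \<sigma>: "\<sigma> \<in> AM Z" using AM_nonempty[OF mZ] by blast
  show ?thesis
  proof (cases "\<exists>a. topspace Z = {a}")
    case True
    then obtain a where a: "topspace Z = {a}" by blast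
    have "\<sigma> \<in> Pp Z" using a by (intro Pp_I[OF \<sigma>, of a a]) auto
    moreover have "\<sigma> = d"
      using a PM_refl[OF d] PM_refl[OF AM_PM[OF \<sigma>]] by (intro PM_eqI[OF AM_PM[OF \<sigma>] d]) auto
    ultimately show ?thesis using that \<epsilon> pm_dist_self[OF Z, of d] by simp
  next
    case False
    then obtain a0 b0 where ab0: "a0 \<in> topspace Z" "b0 \<in> topspace Z" "a0 \<noteq> b0" using Z by blast
    obtain B where B: "B > 0" "\<And>x y. \<sigma> x y \<le> B" using PM_bounded[OF AM_PM[OF \<sigma>]] by metis
    define c where "c = \<epsilon> / (4 * B)"
    have c: "c > 0" using \<epsilon> B by (simp add: c_def)
    define \<tau> where "\<tau> = (\<lambda>x y. d x y + c * \<sigma> x y)"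
    have \<tau>P: "\<tau> \<in> PM Z"
      unfolding \<tau>_def using c by (intro PM_add[OF d] PM_scale[OF AM_PM[OF \<sigma>]]) simp
    have \<tau>: "\<tau> \<in> AM Z"
      using AM_mono[OF \<sigma> \<tau>P c] PM_nonneg[OF d] by (simp add: \<tau>_def)
    have \<tau>d: "0 \<le> \<tau> x y - d x y" "\<tau> x y - d x y \<le> \<epsilon> / 4" for x y
    proof -
      have "c * \<sigma> x y \<le> c * B" using B(2) c by simp
      also have "c * B = \<epsilon> / 4" using B(1) by (simp add: c_def)
      finally show "\<tau> x y - d x y \<le> \<epsilon> / 4" by (simp add: \<tau>_def)
      show "0 \<le> \<tau> x y - d x y" using c PM_nonneg[OF AM_PM[OF \<sigma>], of x y] by (simp add: \<tau>_def)
    qed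
    define N where "N = pm_norm Z \<tau>"
    have N: "\<tau> x y \<le> N" if "x \<in> topspace Z" "y \<in> topspace Z" for x y
      unfolding N_def using pm_norm_upper[OF \<tau>P that] .
    have "N > 0" using N[OF ab0(1,2)] AM_pos[OF \<tau> ab0] by linarith
    \<comment> \<open>The bound \<open>N / 2\<close> gives \<open>s < \<tau> a b\<close>, that is, disjoint bumps.\<close>
    define s where "s = min (\<epsilon> / 8) (N / 2)"
    have s: "s > 0" "s \<le> \<epsilon> / 8" "s \<le> N / 2" using \<epsilon> \<open>N > 0\<close> by (auto simp: s_def)
    obtain a b where ab: "a \<in> topspace Z" "b \<in> topspace Z" "N - s < \<tau> a b"
      using pm_norm_least[OF Z, of \<tau> "N - s"] s(1) unfolding N_def by (meson diff_less_eq less_add_same_cancel1 linorder_not_le)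
    have sab: "s < \<tau> a b" using ab(3) s(3) by linarith
    define F where "F = fun_pm Z (peak_fun \<tau> s a b)"
    have FP: "F \<in> PM Z" unfolding F_def using peak_fun_PM[OF \<tau>P ab(1,2) s(1)] .
    have Fab: "F a b = 2 * s" unfolding F_def using peak_fun_at[OF \<tau>P ab(1,2) s(1) sab] .
    have sandwich: "F x y \<le> s \<or> F x y = 2 * s - 2 * \<tau> x a - 2 * \<tau> y b \<or> F x y = 2 * s - 2 * \<tau> y a - 2 * \<tau> x b"
      if "x \<in> topspace Z" "y \<in> topspace Z" for x y
      unfolding F_def using peak_fun_sandwich[OF \<tau>P ab(1,2) that s(1) sab] .
    define m where "m = (\<lambda>x y. \<tau> x y + F x y)"
    have mP: "m \<in> PM Z" unfolding m_def using PM_add[OF \<tau>P FP] .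
    have m: "m \<in> AM Z"
      using AM_mono[OF \<tau> mP, of 1] PM_nonneg[OF FP] by (simp add: m_def)
    have near: "\<tau> x y + (2 * s - 2 * \<tau> x a - 2 * \<tau> y b) < \<tau> a b + 2 * s"
      if xy: "x \<in> topspace Z" "y \<in> topspace Z" and ne: "x \<noteq> a \<or> y \<noteq> b" for x y
    proof -
      have "\<tau> x y \<le> \<tau> x a + \<tau> a y" "\<tau> a y \<le> \<tau> a b + \<tau> y b"
        using PM_triangle[OF \<tau>P, of x a y] PM_triangle[OF \<tau>P, of a b y] PM_commute[OF \<tau>P, of b y] xy ab
        by auto
      moreover have "0 < \<tau> x a + \<tau> y b"
        using ne AM_pos[OF \<tau> xy(1) ab(1)] AM_pos[OF \<tau> xy(2) ab(2)] PM_nonneg[OF \<tau>P, of x a]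
          PM_nonneg[OF \<tau>P, of y b] by linarith
      ultimately show ?thesis by linarith
    qed
    have "m \<in> Pp Z"
    proof (rule Pp_I[OF m ab(1,2)])
      fix x y assume xy: "x \<in> topspace Z" "y \<in> topspace Z" "{x, y} \<noteq> {a, b}"
      have ne: "x \<noteq> a \<or> y \<noteq> b" "y \<noteq> a \<or> x \<noteq> b" using xy(3) by auto
      show "m x y < m a b"
        unfolding m_def Fab using sandwich[OF xy(1,2)] near[OF xy(1,2) ne(1)] near[OF xy(2,1) ne(2)]
          N[OF xy(1,2)] ab(3) PM_commute[OF \<tau>P, of x y] by linarith
    qed
    moreover have "pm_dist Z m d \<le> \<epsilon> / 2"
    proof (rule pm_dist_least[OF Z])
      fix x y assume xy: "x \<in> topspace Z" "y \<in> topspace Z"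
      have "F x y \<le> 2 * s"
        using sandwich[OF xy] s(1) PM_nonneg[OF \<tau>P, of x a] PM_nonneg[OF \<tau>P, of y b]
          PM_nonneg[OF \<tau>P, of y a] PM_nonneg[OF \<tau>P, of x b] by linarith
      then show "\<bar>m x y - d x y\<bar> \<le> \<epsilon> / 2"
        using \<tau>d[of x y] PM_nonneg[OF FP, of x y] s(2) unfolding m_def by linarith
    qed
    ultimately show ?thesis using that \<epsilon> by fastforce
  qed
qed

section \<open>Extension of isometries by completeness\<close>

lemma PM_complete:
  assumes Z: "topspace Z \<noteq> {}" and q: "\<And>n. q n \<in> PM Z"
    and Cauchy: "\<And>\<epsilon>. \<epsilon> > 0 \<Longrightarrow> \<exists>N. \<forall>m\<ge>N. \<forall>n\<ge>N. pm_dist Z (q m) (q n) < \<epsilon>"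
  obtains l where "l \<in> PM Z" "(\<lambda>n. pm_dist Z (q n) l) \<longlonglongrightarrow> 0"
proof -
  have upper: "\<bar>q m x y - q n x y\<bar> \<le> pm_dist Z (q m) (q n)" for m n x y
    using pm_dist_upper[OF q q, of x y] pm_dist_nonneg[OF Z q q] PM_outside[OF q, of x y]
    by (cases "x \<in> topspace Z \<and> y \<in> topspace Z") auto
  have conv: "convergent (\<lambda>n. q n x y)" for x y
  proof (rule Cauchy_convergent, rule CauchyI)
    fix \<epsilon> :: real assume "\<epsilon> > 0"
    then obtain N where "\<forall>m\<ge>N. \<forall>n\<ge>N. pm_dist Z (q m) (q n) < \<epsilon>" using Cauchy by blast
    then show "\<exists>N. \<forall>m\<ge>N. \<forall>n\<ge>N. norm (q m x y - q n x y) < \<epsilon>"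
      using upper by (metis le_less_trans real_norm_def)
  qed
  define l where "l x y = lim (\<lambda>n. q n x y)" for x y
  have l: "(\<lambda>n. q n x y) \<longlonglongrightarrow> l x y" for x y
    unfolding l_def using conv by (simp add: convergent_LIMSEQ_iff)
  have unif: "\<exists>N. \<forall>n\<ge>N. \<forall>x y. \<bar>q n x y - l x y\<bar> \<le> \<epsilon>" if "\<epsilon> > 0" for \<epsilon>
  proof -
    obtain N where N: "\<And>m n. m \<ge> N \<Longrightarrow> n \<ge> N \<Longrightarrow> pm_dist Z (q m) (q n) < \<epsilon>"
      using Cauchy[OF \<open>\<epsilon> > 0\<close>] by blast
    have "\<bar>q n x y - l x y\<bar> \<le> \<epsilon>" if "n \<ge> N" for n x y
    proof (rule LIMSEQ_le_const2)
      show "(\<lambda>m. \<bar>q n x y - q m x y\<bar>) \<longlonglongrightarrow> \<bar>q n x y - l x y\<bar>"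
        by (intro tendsto_intros l)
      show "\<exists>M. \<forall>m\<ge>M. \<bar>q n x y - q m x y\<bar> \<le> \<epsilon>"
        using N[OF that] upper[of n x y] by (metis le_less_trans less_imp_le)
    qed
    then show ?thesis by blast
  qed
  have lP: "l \<in> PM Z"
  proof -
    obtain N where N: "\<And>x y. \<bar>q N x y - l x y\<bar> \<le> 1" using unif[of 1] by auto
    obtain B where B: "\<And>x y. q N x y \<le> B" using PM_bounded[OF q] by metis
    show ?thesis
    proof (rule PM_I[where B = "B + 1"])
      show "l x y = 0" if "x \<notin> topspace Z \<or> y \<notin> topspace Z" for x y
      proof (rule LIMSEQ_unique[OF l])
        show "(\<lambda>n. q n x y) \<longlonglongrightarrow> 0" using PM_outside[OF q that] by simp
      qed
      show "0 \<le> l x y" for x y using LIMSEQ_le_const[OF l] PM_nonneg[OF q] by blast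
      show "l x x = 0" for x
      proof (rule LIMSEQ_unique[OF l])
        show "(\<lambda>n. q n x x) \<longlonglongrightarrow> 0" using PM_refl[OF q] by simp
      qed
      show "l x y = l y x" for x y
      proof (rule LIMSEQ_unique[OF l])
        show "(\<lambda>n. q n x y) \<longlonglongrightarrow> l y x" using l[of y x] PM_commute[OF q, of _ x y] by simp
      qed
      show "l x z \<le> l x y + l y z" if "x \<in> topspace Z" "y \<in> topspace Z" "z \<in> topspace Z" for x y z
        using LIMSEQ_le[OF l tendsto_add[OF l l]] PM_triangle[OF q that] by blast
      show "l x y \<le> B + 1" for x y using N[of x y] B[of x y] by linarith
      fix a and \<epsilon> :: real assume a: "a \<in> topspace Z" and "\<epsilon> > 0"
      then have \<epsilon>2: "\<epsilon> / 2 > 0" by simp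
      obtain n where n: "\<And>x y. \<bar>q n x y - l x y\<bar> \<le> \<epsilon> / 2" using unif[OF \<epsilon>2] by blast
      obtain U where U: "openin Z U" "a \<in> U" "\<And>x. x \<in> U \<Longrightarrow> q n a x < \<epsilon> / 2"
        using PM_small_nhd[OF q a \<epsilon>2] by blast
      have "l a x < \<epsilon>" if "x \<in> U" for x using n[of a x] U(3)[OF that] by linarith
      then show "\<exists>U. openin Z U \<and> a \<in> U \<and> (\<forall>x\<in>U. l a x < \<epsilon>)" using U by blast
    qed
  qed
  have "(\<lambda>n. pm_dist Z (q n) l) \<longlonglongrightarrow> 0"
  proof (rule LIMSEQ_I)
    fix \<epsilon> :: real assume "\<epsilon> > 0"
    then obtain N where N: "\<And>n x y. n \<ge> N \<Longrightarrow> \<bar>q n x y - l x y\<bar> \<le> \<epsilon> / 2" using unif[of "\<epsilon> / 2"] by auto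
    have "norm (pm_dist Z (q n) l - 0) < \<epsilon>" if "n \<ge> N" for n
      using pm_dist_least[OF Z, of "q n" l "\<epsilon> / 2"] N[OF that] pm_dist_nonneg[OF Z q lP, of n] \<open>\<epsilon> > 0\<close>
      by simp
    then show "\<exists>N. \<forall>n\<ge>N. norm (pm_dist Z (q n) l - 0) < \<epsilon>" by blast
  qed
  then show ?thesis using that lP by blast
qed

lemma pm_dist_tendsto:
  assumes Z: "topspace Z \<noteq> {}" and m: "\<And>n. m n \<in> PM Z" "\<And>n. m' n \<in> PM Z" "d \<in> PM Z" "d' \<in> PM Z"
    and lim: "(\<lambda>n. pm_dist Z (m n) d) \<longlonglongrightarrow> 0" "(\<lambda>n. pm_dist Z (m' n) d') \<longlonglongrightarrow> 0"
  shows "(\<lambda>n. pm_dist Z (m n) (m' n)) \<longlonglongrightarrow> pm_dist Z d d'"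
proof (rule LIM_zero_cancel, rule Lim_null_comparison)
  show "(\<lambda>n. pm_dist Z (m n) d + pm_dist Z (m' n) d') \<longlonglongrightarrow> 0"
    using tendsto_add[OF lim] by simp
  have "norm (pm_dist Z (m n) (m' n) - pm_dist Z d d') \<le> pm_dist Z (m n) d + pm_dist Z (m' n) d'" for n
    using pm_dist_triangle[OF Z m(1) m(3) m(2), of n n] pm_dist_triangle[OF Z m(3) m(4) m(2), of n]
      pm_dist_triangle[OF Z m(3) m(1) m(4), of n] pm_dist_triangle[OF Z m(1) m(2) m(4), of n n]
      pm_dist_commute[of Z "m n" d] pm_dist_commute[of Z "m' n" d'] by (simp add: abs_le_iff)
  then show "\<forall>\<^sub>F n in sequentially. norm (pm_dist Z (m n) (m' n) - pm_dist Z d d')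
      \<le> pm_dist Z (m n) d + pm_dist Z (m' n) d'" by simp
qed

lemma isometry_image_convergent:
  assumes Y: "topspace Y \<noteq> {}" and A: "A \<subseteq> PM X" and B: "B \<subseteq> PM Y" and T: "pm_isometry X A Y B T"
    and X: "topspace X \<noteq> {}" and m: "\<And>n. m n \<in> A" and d: "d \<in> PM X"
    and lim: "(\<lambda>n. pm_dist X (m n) d) \<longlonglongrightarrow> 0"
  obtains q where "q \<in> PM Y" "(\<lambda>n. pm_dist Y (T (m n)) q) \<longlonglongrightarrow> 0"
proof (rule PM_complete[OF Y, of "\<lambda>n. T (m n)"])
  show "T (m n) \<in> PM Y" for n using isometry_in[OF T m] B by blast
  show "\<exists>N. \<forall>k\<ge>N. \<forall>n\<ge>N. pm_dist Y (T (m k)) (T (m n)) < \<epsilon>" if "\<epsilon> > 0" for \<epsilon>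
  proof -
    have mP: "m n \<in> PM X" for n using m A by blast
    have "\<forall>\<^sub>F n in sequentially. pm_dist X (m n) d < \<epsilon> / 2"
      using order_tendstoD(2)[OF lim, of "\<epsilon> / 2"] that by simp
    then obtain N where N: "\<And>n. n \<ge> N \<Longrightarrow> pm_dist X (m n) d < \<epsilon> / 2"
      unfolding eventually_sequentially by blast
    have "pm_dist Y (T (m k)) (T (m n)) < \<epsilon>" if "k \<ge> N" "n \<ge> N" for k n
      using N[OF that(1)] N[OF that(2)] pm_dist_triangle[OF X mP d mP, of k n]
        pm_dist_commute[of X d "m n"] isometry_dist[OF T m m, of k n] by linarith
    then show ?thesis by blast
  qed
qed (use that in blast)

lemma pm_dist_approximating_sequence:
  assumes Z: "topspace Z \<noteq> {}" and C: "C \<subseteq> PM Z" and d: "d \<in> PM Z"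
    and dense: "\<And>\<epsilon>. \<epsilon> > 0 \<Longrightarrow> \<exists>m\<in>C. pm_dist Z m d < \<epsilon>"
  obtains m where "\<And>n. m n \<in> C" "(\<lambda>n. pm_dist Z (m n) d) \<longlonglongrightarrow> 0"
proof -
  have "\<exists>m\<in>C. pm_dist Z m d < inverse (real (Suc n))" for n
    using dense[of "inverse (real (Suc n))"] by simp
  then obtain m where m: "\<And>n. m n \<in> C" "\<And>n. pm_dist Z (m n) d < inverse (real (Suc n))" by metis
  have "m n \<in> PM Z" for n using m(1) C by blast
  then have "0 \<le> pm_dist Z (m n) d" for n using pm_dist_nonneg[OF Z _ d] by blast
  then have "(\<lambda>n. pm_dist Z (m n) d) \<longlonglongrightarrow> 0"
    using m(2) by (intro tendsto_sandwich[OF _ _ tendsto_const LIMSEQ_inverse_real_of_nat])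
      (auto intro!: always_eventually less_imp_le)
  then show ?thesis using that m(1) by blast
qed

text \<open>
The usual extension by completeness. The relation \<open>R\<close> of being limits of corresponding
sequences is total, onto and distance preserving, so choosing a value for each argument gives the
extension.
\<close>

lemma isometry_extends_to_PM:
  assumes X: "topspace X \<noteq> {}" and Y: "topspace Y \<noteq> {}"
    and A: "A \<subseteq> PM X" and B: "B \<subseteq> PM Y" and T: "pm_isometry X A Y B T"
    and dense_A: "\<And>d \<epsilon>. d \<in> PM X \<Longrightarrow> \<epsilon> > 0 \<Longrightarrow> \<exists>m\<in>A. pm_dist X m d < \<epsilon>"
    and dense_B: "\<And>q \<epsilon>. q \<in> PM Y \<Longrightarrow> \<epsilon> > 0 \<Longrightarrow> \<exists>m\<in>B. pm_dist Y m q < \<epsilon>"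
  obtains E where "pm_isometry X (PM X) Y (PM Y) E"
proof -
  define R where "R d q \<longleftrightarrow> (\<exists>m. (\<forall>n. m n \<in> A) \<and> (\<lambda>n. pm_dist X (m n) d) \<longlonglongrightarrow> 0 \<and>
      (\<lambda>n. pm_dist Y (T (m n)) q) \<longlonglongrightarrow> 0)" for d q
  have R_total: "\<exists>q\<in>PM Y. R d q" if d: "d \<in> PM X" for d
  proof -
    obtain m where m: "\<And>n. m n \<in> A" "(\<lambda>n. pm_dist X (m n) d) \<longlonglongrightarrow> 0"
      using pm_dist_approximating_sequence[OF X A d dense_A[OF d]] by blast
    obtain q where "q \<in> PM Y" "(\<lambda>n. pm_dist Y (T (m n)) q) \<longlonglongrightarrow> 0"
      using isometry_image_convergent[OF Y A B T X m(1) d m(2)] by blast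
    then show ?thesis using m unfolding R_def by blast
  qed
  have R_surj: "\<exists>d\<in>PM X. R d q" if q: "q \<in> PM Y" for q
  proof -
    note S = isometry_inverse[OF T A Y]
    obtain m where m: "\<And>n. m n \<in> B" "(\<lambda>n. pm_dist Y (m n) q) \<longlonglongrightarrow> 0"
      using pm_dist_approximating_sequence[OF Y B q dense_B[OF q]] by blast
    obtain d where d: "d \<in> PM X" "(\<lambda>n. pm_dist X (inv_into A T (m n)) d) \<longlonglongrightarrow> 0"
      using isometry_image_convergent[OF X B A S(1) Y m(1) q m(2)] by blast
    have "R d q" unfolding R_def
      using d(2) m S(3)[OF m(1)] S(4)[OF m(1)] by (intro exI[of _ "\<lambda>n. inv_into A T (m n)"]) simp
    then show ?thesis using d(1) by blast
  qed
  have R_dist: "pm_dist Y q q' = pm_dist X d d'"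
    if R: "R d q" "R d' q'" and P: "d \<in> PM X" "d' \<in> PM X" "q \<in> PM Y" "q' \<in> PM Y" for d d' q q'
  proof -
    obtain m where m: "\<And>n. m n \<in> A" "(\<lambda>n. pm_dist X (m n) d) \<longlonglongrightarrow> 0"
      "(\<lambda>n. pm_dist Y (T (m n)) q) \<longlonglongrightarrow> 0" using R(1) unfolding R_def by blast
    obtain m' where m': "\<And>n. m' n \<in> A" "(\<lambda>n. pm_dist X (m' n) d') \<longlonglongrightarrow> 0"
      "(\<lambda>n. pm_dist Y (T (m' n)) q') \<longlonglongrightarrow> 0" using R(2) unfolding R_def by blast
    have mP: "m n \<in> PM X" "m' n \<in> PM X" "T (m n) \<in> PM Y" "T (m' n) \<in> PM Y" for n
      using m(1)[of n] m'(1)[of n] A B isometry_in[OF T] by blast+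
    have "(\<lambda>n. pm_dist Y (T (m n)) (T (m' n))) \<longlonglongrightarrow> pm_dist Y q q'"
      using pm_dist_tendsto[OF Y mP(3,4) P(3,4) m(3) m'(3)] .
    moreover have "(\<lambda>n. pm_dist Y (T (m n)) (T (m' n))) \<longlonglongrightarrow> pm_dist X d d'"
      using pm_dist_tendsto[OF X mP(1,2) P(1,2) m(2) m'(2)] isometry_dist[OF T m(1) m'(1)] by simp
    ultimately show ?thesis by (rule LIMSEQ_unique)
  qed
  define E where "E d = (SOME q. q \<in> PM Y \<and> R d q)" for d
  have E: "E d \<in> PM Y" "R d (E d)" if "d \<in> PM X" for d
  proof -
    have "\<exists>q. q \<in> PM Y \<and> R d q" using R_total[OF that] by blast
    from someI_ex[OF this] show "E d \<in> PM Y" "R d (E d)" unfolding E_def by auto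
  qed
  have "q \<in> E ` PM X" if q: "q \<in> PM Y" for q
  proof -
    obtain d where d: "d \<in> PM X" "R d q" using R_surj[OF q] by blast
    have "pm_dist Y q (E d) = 0"
      using R_dist[OF d(2) E(2)[OF d(1)] d(1) d(1) q E(1)[OF d(1)]] pm_dist_self[OF X] by simp
    then have "q = E d" using pm_dist_zero_imp_eq[OF q E(1)[OF d(1)]] by blast
    then show ?thesis using d(1) by blast
  qed
  then have "E ` PM X = PM Y" using E(1) by blast
  then have "pm_isometry X (PM X) Y (PM Y) E"
    unfolding pm_isometry_def using R_dist[OF E(2) E(2) _ _ E(1) E(1)] by simp
  then show ?thesis using that by blast
qed

section \<open>Isometries induced by homeomorphisms\<close>

text \<open>
The value is cut off to \<open>0\<close> outside the space, as membership in \<^const>\<open>PM\<close> requires.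
\<close>

definition pullback :: "'b topology \<Rightarrow> ('b \<Rightarrow> 'a) \<Rightarrow> ('a \<Rightarrow> 'a \<Rightarrow> real) \<Rightarrow> 'b \<Rightarrow> 'b \<Rightarrow> real" where
  "pullback Y g d x y = (if x \<in> topspace Y \<and> y \<in> topspace Y then d (g x) (g y) else 0)"

lemma pullback_PM:
  assumes g: "continuous_map Y X g" and d: "d \<in> PM X"
  shows "pullback Y g d \<in> PM Y"
proof -
  have gX: "g y \<in> topspace X" if "y \<in> topspace Y" for y
    using continuous_map_image_subset_topspace[OF g] that by blast
  obtain B where B: "B > 0" "\<And>x y. d x y \<le> B" using PM_bounded[OF d] by metis
  show ?thesis
  proof (rule PM_I[where B = B])
    fix a and \<epsilon> :: real assume a: "a \<in> topspace Y" "\<epsilon> > 0"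
    obtain U where U: "openin X U" "g a \<in> U" "\<And>x. x \<in> U \<Longrightarrow> d (g a) x < \<epsilon>"
      using PM_small_nhd[OF d gX[OF a(1)] a(2)] by blast
    have "openin Y {x \<in> topspace Y. g x \<in> U}" using openin_continuous_map_preimage[OF g U(1)] .
    then show "\<exists>V. openin Y V \<and> a \<in> V \<and> (\<forall>x\<in>V. pullback Y g d a x < \<epsilon>)"
      using U a by (intro exI[of _ "{x \<in> topspace Y. g x \<in> U}"]) (auto simp: pullback_def)
  qed (use B PM_nonneg[OF d] PM_refl[OF d] PM_commute[OF d] PM_triangle[OF d] gX
      in \<open>auto simp: pullback_def\<close>)
qed

lemma homeomorphic_maps_image:
  assumes "homeomorphic_maps X Y f g"
  shows "g ` topspace Y = topspace X"
  using assms homeomorphic_imp_surjective_map homeomorphic_maps_map homeomorphic_maps_sym by metis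

lemma pullback_AM:
  assumes h: "homeomorphic_maps X Y f g" and d: "d \<in> AM X"
  shows "pullback Y g d \<in> AM Y"
proof -
  have g: "continuous_map Y X g" and f: "continuous_map X Y f"
    and fg: "\<And>y. y \<in> topspace Y \<Longrightarrow> f (g y) = y" and gf: "\<And>x. x \<in> topspace X \<Longrightarrow> g (f x) = x"
    using h unfolding homeomorphic_maps_def by auto
  have gX: "g y \<in> topspace X" if "y \<in> topspace Y" for y
    using homeomorphic_maps_image[OF h] that by blast
  show ?thesis
  proof (rule AM_I[OF pullback_PM[OF g AM_PM[OF d]]])
    fix x y assume xy: "x \<in> topspace Y" "y \<in> topspace Y" "x \<noteq> y"
    then have "g x \<noteq> g y" using fg by metis
    then show "pullback Y g d x y \<noteq> 0"
      using AM_pos[OF d gX[OF xy(1)] gX[OF xy(2)]] xy by (simp add: pullback_def)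
  next
    fix x U assume U: "openin Y U" "x \<in> U"
    have x: "x \<in> topspace Y" using U openin_subset by blast
    have "openin X {z \<in> topspace X. f z \<in> U}" using openin_continuous_map_preimage[OF f U(1)] .
    then obtain r where "r > 0" "\<forall>z\<in>topspace X. d (g x) z < r \<longrightarrow> f z \<in> U"
      using gX[OF x] fg[OF x] U(2) unfolding AM_openin[OF d] by force
    then show "\<exists>r>0. \<forall>y\<in>topspace Y. pullback Y g d x y < r \<longrightarrow> y \<in> U"
      using x gX fg by (intro exI[of _ r]) (fastforce simp: pullback_def)
  qed
qed

lemma pm_dist_pullback:
  assumes h: "homeomorphic_maps X Y f g"
  shows "pm_dist Y (pullback Y g d) (pullback Y g e) = pm_dist X d e"
proof -
  have "(\<lambda>(z, w). \<bar>d z w - e z w\<bar>) ` (topspace X \<times> topspace X) =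
        (\<lambda>(z, w). \<bar>pullback Y g d z w - pullback Y g e z w\<bar>) ` (topspace Y \<times> topspace Y)"
    unfolding homeomorphic_maps_image[OF h, symmetric] pullback_def by force
  then show ?thesis unfolding pm_dist_def by simp
qed

lemma pm_norm_pullback:
  assumes h: "homeomorphic_maps X Y f g"
  shows "pm_norm Y (pullback Y g d) = pm_norm X d"
proof -
  have "(\<lambda>(z, w). d z w) ` (topspace X \<times> topspace X) =
        (\<lambda>(z, w). pullback Y g d z w) ` (topspace Y \<times> topspace Y)"
    unfolding homeomorphic_maps_image[OF h, symmetric] pullback_def by force
  then show ?thesis unfolding pm_norm_def by simp
qed

lemma pullback_Pc:
  assumes h: "homeomorphic_maps X Y f g" and d: "d \<in> Pc X"
  shows "pullback Y g d \<in> Pc Y"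
proof -
  obtain K where dA: "d \<in> AM X" and K: "compactin X K"
    "\<And>x y. x \<in> topspace X \<Longrightarrow> y \<in> topspace X \<Longrightarrow> d x y = pm_norm X d \<Longrightarrow> x \<in> K \<and> y \<in> K"
    using d unfolding Pc_def by blast
  have f: "continuous_map X Y f" and fg: "\<And>y. y \<in> topspace Y \<Longrightarrow> f (g y) = y"
    using h unfolding homeomorphic_maps_def by auto
  have gX: "g y \<in> topspace X" if "y \<in> topspace Y" for y
    using homeomorphic_maps_image[OF h] that by blast
  have "x \<in> f ` K \<and> y \<in> f ` K"
    if "x \<in> topspace Y" "y \<in> topspace Y" "pullback Y g d x y = pm_norm X d" for x y
    using K(2)[OF gX[OF that(1)] gX[OF that(2)]] that fg[OF that(1)] fg[OF that(2)]
    by (metis imageI pullback_def)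
  moreover have "compactin Y (f ` K)" using image_compactin[OF K(1) f] .
  ultimately show ?thesis
    unfolding Pc_def pm_norm_pullback[OF h] using pullback_AM[OF h dA] pm_norm_pullback[OF h, of d] by auto
qed

lemma pullback_Pp:
  assumes h: "homeomorphic_maps X Y f g" and d: "d \<in> Pp X"
  shows "pullback Y g d \<in> Pp Y"
proof -
  obtain z w where dA: "d \<in> AM X" and zw: "z \<in> topspace X" "w \<in> topspace X"
    and less: "\<And>x y. x \<in> topspace X \<Longrightarrow> y \<in> topspace X \<Longrightarrow> {x, y} \<noteq> {z, w} \<Longrightarrow> d x y < d z w"
    using Pp_E[OF d] by metis
  have f: "continuous_map X Y f" and fg: "\<And>y. y \<in> topspace Y \<Longrightarrow> f (g y) = y"
    and gf: "\<And>x. x \<in> topspace X \<Longrightarrow> g (f x) = x"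
    using h unfolding homeomorphic_maps_def by auto
  have gX: "g y \<in> topspace X" if "y \<in> topspace Y" for y
    using homeomorphic_maps_image[OF h] that by blast
  have fzw: "f z \<in> topspace Y" "f w \<in> topspace Y"
    using continuous_map_image_subset_topspace[OF f] zw by auto
  show ?thesis
  proof (rule Pp_I[OF pullback_AM[OF h dA] fzw])
    fix x y assume xy: "x \<in> topspace Y" "y \<in> topspace Y" "{x, y} \<noteq> {f z, f w}"
    have "{g x, g y} \<noteq> {z, w}"
    proof
      assume "{g x, g y} = {z, w}"
      then have "f ` {g x, g y} = f ` {z, w}" by simp
      then show False using xy fg by simp
    qed
    then show "pullback Y g d x y < pullback Y g d (f z) (f w)"
      using less[OF gX[OF xy(1)] gX[OF xy(2)]] xy fzw gf zw by (simp add: pullback_def)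
  qed
qed

lemma pullback_isometry:
  assumes h: "homeomorphic_maps X Y f g" and B: "B \<subseteq> PM Y"
    and forth: "\<And>d. d \<in> A \<Longrightarrow> pullback Y g d \<in> B" and inverse: "\<And>q. q \<in> B \<Longrightarrow> pullback X f q \<in> A"
  shows "pm_isometry X A Y B (pullback Y g)"
proof -
  have "q \<in> pullback Y g ` A" if q: "q \<in> B" for q
  proof -
    have "pullback Y g (pullback X f q) = q"
    proof (intro ext)
      have qP: "q \<in> PM Y" using q B by blast
      have fg: "f (g y) = y" "g y \<in> topspace X" if "y \<in> topspace Y" for y
        using h homeomorphic_maps_image[OF h] that unfolding homeomorphic_maps_def by auto
      show "pullback Y g (pullback X f q) x y = q x y" for x y
        using fg PM_outside[OF qP, of x y] by (auto simp: pullback_def)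
    qed
    then show ?thesis using inverse[OF q] by (metis imageI)
  qed
  then show ?thesis unfolding pm_isometry_def using forth pm_dist_pullback[OF h] by blast
qed

lemma isometry_restrict:
  assumes "pm_isometry X A Y B T" "C \<subseteq> A" "T ` C = D"
  shows "pm_isometry X C Y D T"
  using assms unfolding pm_isometry_def by blast

section \<open>Isometries and homeomorphisms\<close>

theorem theorem1:
  fixes X :: "'a topology" and Y :: "'b topology"
    and MX :: "('a \<Rightarrow> 'a \<Rightarrow> real) set" and MY :: "('b \<Rightarrow> 'b \<Rightarrow> real) set"
  assumes "metrizable_space X" and "metrizable_space Y"
    and "topspace X \<noteq> {}" and "topspace Y \<noteq> {}"
    and "(MX = Pc X \<and> MY = Pc Y) \<or> (MX = Pp X \<and> MY = Pp Y)"
  shows "(X homeomorphic_space Y \<longleftrightarrow> (\<exists>T. pm_isometry X (PM X) Y (PM Y) T \<and> T ` MX = MY)) \<and>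
         (X homeomorphic_space Y \<longleftrightarrow> (\<exists>T. pm_isometry X (AM X) Y (AM Y) T \<and> T ` MX = MY)) \<and>
         (X homeomorphic_space Y \<longleftrightarrow> (\<exists>T. pm_isometry X MX Y MY T)) \<and>
         (\<forall>T. pm_isometry X (PM X) Y (PM Y) T \<and> T ` MX = MY \<longrightarrow>
            (\<exists>\<phi>. homeomorphic_map Y X \<phi> \<and>
                 (\<forall>d\<in>PM X. \<forall>x\<in>topspace Y. \<forall>y\<in>topspace Y. T d x y = d (\<phi> x) (\<phi> y)) \<and>
                 (\<not> (card (topspace X) = 2 \<or> card (topspace Y) = 2) \<longrightarrow>
                   (\<forall>\<psi>. homeomorphic_map Y X \<psi> \<and>
                        (\<forall>d\<in>PM X. \<forall>x\<in>topspace Y. \<forall>y\<in>topspace Y. T d x y = d (\<psi> x) (\<psi> y)) \<longrightarrow>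
                        (\<forall>y\<in>topspace Y. \<psi> y = \<phi> y)))))"
proof -
  note mX = assms(1) and mY = assms(2) and X = assms(3) and Y = assms(4) and M = assms(5)
  have MX: "Pp X \<subseteq> MX" "MX \<subseteq> AM X" and MY: "Pp Y \<subseteq> MY" "MY \<subseteq> AM Y"
    using M Pp_subset_Pc[of X] Pp_subset_Pc[of Y] Pc_subset_AM[of X] Pc_subset_AM[of Y] by auto
  have AP: "AM X \<subseteq> PM X" "AM Y \<subseteq> PM Y" using AM_PM by blast+
  have MP: "MX \<subseteq> PM X" "MY \<subseteq> PM Y" using MX MY AP by blast+
  have dense: "\<exists>m\<in>MX. pm_dist X m d < \<epsilon>" if "d \<in> PM X" "\<epsilon> > 0" for d \<epsilon>
    by (rule Pp_dense[OF mX X that]) (use MX(1) in blast)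
  have dense': "\<exists>m\<in>MY. pm_dist Y m d < \<epsilon>" if "d \<in> PM Y" "\<epsilon> > 0" for d \<epsilon>
    by (rule Pp_dense[OF mY Y that]) (use MY(1) in blast)
  have from_M: "X homeomorphic_space Y" if T: "pm_isometry X MX Y MY T" for T
  proof -
    obtain E where E: "pm_isometry X (PM X) Y (PM Y) E"
      by (rule isometry_extends_to_PM[OF X Y MP T dense dense'])
    obtain \<phi> where "homeomorphic_map Y X \<phi>"
      using PM_isometry_induced_by_homeomorphism[OF mX mY X Y E] by blast
    then show ?thesis using homeomorphic_map_imp_homeomorphic_space homeomorphic_space_sym by blast
  qed
  have to_all: "\<exists>T. pm_isometry X (PM X) Y (PM Y) T \<and> pm_isometry X (AM X) Y (AM Y) T \<and>
      pm_isometry X MX Y MY T \<and> T ` MX = MY"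
    if XY: "X homeomorphic_space Y"
  proof -
    obtain f g where h: "homeomorphic_maps X Y f g" using XY unfolding homeomorphic_space_def by blast
    have h': "homeomorphic_maps Y X g f" by (rule homeomorphic_maps_sym[THEN iffD1, OF h])
    have c: "continuous_map X Y f" "continuous_map Y X g" using h unfolding homeomorphic_maps_def by auto
    have "pm_isometry X (PM X) Y (PM Y) (pullback Y g)"
      by (rule pullback_isometry[OF h subset_refl pullback_PM[OF c(2)] pullback_PM[OF c(1)]])
    moreover have "pm_isometry X (AM X) Y (AM Y) (pullback Y g)"
      by (rule pullback_isometry[OF h AP(2) pullback_AM[OF h] pullback_AM[OF h']])
    moreover have "pm_isometry X MX Y MY (pullback Y g)"
    proof (rule pullback_isometry[OF h MP(2)])
      show "pullback Y g d \<in> MY" if "d \<in> MX" for d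
        using M that pullback_Pc[OF h, of d] pullback_Pp[OF h, of d] by (elim disjE conjE) simp_all
      show "pullback X f d \<in> MX" if "d \<in> MY" for d
        using M that pullback_Pc[OF h', of d] pullback_Pp[OF h', of d] by (elim disjE conjE) simp_all
    qed
    moreover from this have "pullback Y g ` MX = MY" unfolding pm_isometry_def by (rule conjunct1)
    ultimately show ?thesis by (intro exI conjI)
  qed
  have from_PM: "X homeomorphic_space Y" if "pm_isometry X (PM X) Y (PM Y) T" "T ` MX = MY" for T
    using from_M[OF isometry_restrict[OF that(1) MP(1) that(2)]] .
  have from_AM: "X homeomorphic_space Y" if "pm_isometry X (AM X) Y (AM Y) T" "T ` MX = MY" for T
    using from_M[OF isometry_restrict[OF that(1) MX(2) that(2)]] .
  have "X homeomorphic_space Y \<longleftrightarrow> (\<exists>T. pm_isometry X (PM X) Y (PM Y) T \<and> T ` MX = MY)"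
    "X homeomorphic_space Y \<longleftrightarrow> (\<exists>T. pm_isometry X (AM X) Y (AM Y) T \<and> T ` MX = MY)"
    "X homeomorphic_space Y \<longleftrightarrow> (\<exists>T. pm_isometry X MX Y MY T)"
  proof -
    show "X homeomorphic_space Y \<longleftrightarrow> (\<exists>T. pm_isometry X (PM X) Y (PM Y) T \<and> T ` MX = MY)"
      using to_all from_PM by (intro iffI) (fast, elim exE conjE)
    show "X homeomorphic_space Y \<longleftrightarrow> (\<exists>T. pm_isometry X (AM X) Y (AM Y) T \<and> T ` MX = MY)"
      using to_all from_AM by (intro iffI) (fast, elim exE conjE)
    show "X homeomorphic_space Y \<longleftrightarrow> (\<exists>T. pm_isometry X MX Y MY T)"
      using to_all from_M by (intro iffI) (fast, elim exE conjE)
  qed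
  moreover have main: "\<exists>\<phi>. homeomorphic_map Y X \<phi> \<and>
      (\<forall>d\<in>PM X. \<forall>x\<in>topspace Y. \<forall>y\<in>topspace Y. T d x y = d (\<phi> x) (\<phi> y)) \<and>
      (\<not> (card (topspace X) = 2 \<or> card (topspace Y) = 2) \<longrightarrow>
        (\<forall>\<psi>. homeomorphic_map Y X \<psi> \<and>
          (\<forall>d\<in>PM X. \<forall>x\<in>topspace Y. \<forall>y\<in>topspace Y. T d x y = d (\<psi> x) (\<psi> y)) \<longrightarrow>
          (\<forall>y\<in>topspace Y. \<psi> y = \<phi> y)))"
    if T: "pm_isometry X (PM X) Y (PM Y) T" for T
  proof -
    obtain \<phi> where \<phi>: "homeomorphic_map Y X \<phi>"
      "\<forall>d\<in>PM X. \<forall>x\<in>topspace Y. \<forall>y\<in>topspace Y. T d x y = d (\<phi> x) (\<phi> y)"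
      using PM_isometry_induced_by_homeomorphism[OF mX mY X Y T] by blast
    have unique: "\<psi> y = \<phi> y"
      if card: "\<not> (card (topspace X) = 2 \<or> card (topspace Y) = 2)" and \<psi>: "homeomorphic_map Y X \<psi>"
        "\<forall>d\<in>PM X. \<forall>x\<in>topspace Y. \<forall>y\<in>topspace Y. T d x y = d (\<psi> x) (\<psi> y)"
        and y: "y \<in> topspace Y" for \<psi> y
    proof (rule inducing_map_unique[OF mX _ \<phi>(1) \<psi>(1) _ y])
      show "card (topspace Y) \<noteq> 2" using card by blast
      show "d (\<phi> u) (\<phi> v) = d (\<psi> u) (\<psi> v)"
        if "d \<in> PM X" "u \<in> topspace Y" "v \<in> topspace Y" for d u v
        using \<phi>(2)[rule_format, OF that] \<psi>(2)[rule_format, OF that] by simp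
    qed
    show ?thesis
    proof (intro exI[of _ \<phi>] conjI \<phi> impI allI ballI)
      fix \<psi> y
      assume "\<not> (card (topspace X) = 2 \<or> card (topspace Y) = 2)" "y \<in> topspace Y"
        and "homeomorphic_map Y X \<psi> \<and>
          (\<forall>d\<in>PM X. \<forall>x\<in>topspace Y. \<forall>y\<in>topspace Y. T d x y = d (\<psi> x) (\<psi> y))"
      then show "\<psi> y = \<phi> y" using unique by (elim conjE)
    qed
  qed
  ultimately show ?thesis
    by (intro conjI allI impI main) (assumption | elim conjE)+
qed

end
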